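(* There is a randomized algorithm (ApproxZeta) with the following guarantee. Given $q_0,q_1$ satisfying Assumption (A), a pair $(\xi,\bar\zeta)$ such that $(q_0,q_1)$ is $(\xi,\bar\zeta)$-regular, a number $\hat\gamma\geq 0$ with $\lambda_{\min}(A(\hat\gamma))\geq\xi$, and a failure probability $p>0$, with probability at least $1-p$ it outputs $\zeta$ such that $$\zeta^*\leq\zeta\leq 4\zeta^*,$$ and runs in time $$\tilde O\left(\frac{N\sqrt{\zeta^*}}{\sqrt{\xi}}\log\left(\frac{n}{p}\right)\log\left(\frac{1}{\xi}\right)\log\left(\frac{\bar\zeta}{\zeta^*}\right)^2\right).$$
   Context: For symmetric $A_0,A_1\in\mathbb{R}^{n\times n}$, $b_0,b_1\in\mathbb{R}^n$, $c_0,c_1\in\mathbb{R}$, let $q_i(x)=x^\top A_ix+2b_i^\top x+c_i$ ($i=0,1$) and $A(\gamma)=A_0+\gamma A_1$. Assumption (A): $A_0$ and $A_1$ each have a negative eigenvalue, there exists $\gamma^*\geq 0$ with $A(\gamma^* )\succ 0$, and $\|A_0\|,\|A_1\|,\|b_0\|,\|b_1\|,|c_1|\leq 1$ (spectral norm for matrices, Euclidean norm for vectors). Under (A), $\Gamma:=\{\gamma\geq0: A(\gamma)\succeq 0\}$ is a nonempty compact interval $[\gamma_-,\gamma_+]$. $\xi^*:=\min\{1,\max_{\gamma\geq 0}\lambda_{\min}(A(\gamma))\}$, $\zeta^*:=\max\{1,\gamma_+\}$; $(q_0,q_1)$ is $(\xi,\zeta)$-regular if $0<\xi\leq\xi^*$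 and $\zeta\geq\zeta^*$. $\lambda_{\min}$ is the smallest eigenvalue. $N$ is the number of nonzero entries of $A_0$ and $A_1$; $\tilde O$ hides $\log\log$ factors. *)

theory Defs
  imports "HOL-Probability.Probability" "Jordan_Normal_Form.Char_Poly"
begin

section \<open>Pairs of quadratic functions\<close>

text \<open>A record \<open>q\<close> stands for the function
  \<open>x \<mapsto> x\<^sup>T A x + 2 b\<^sup>T x + c\<close> on \<open>\<real>\<^sup>n\<close>. The dimension is not part of the type because
  a single program has to serve all dimensions.\<close>

record quadratic =
  qmat :: "real mat"
  qvec :: "real Matrix.vec"
  qconst :: real

definition vnorm :: "real Matrix.vec \<Rightarrow> real" where
  "vnorm x = sqrt (scalar_prod x x)"

definition spectral_norm :: "real mat \<Rightarrow> real" where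
  "spectral_norm A = Sup {vnorm (A *\<^sub>v x) | x. x \<in> carrier_vec (dim_col A) \<and> vnorm x = 1}"

definition pos_semidef :: "real mat \<Rightarrow> bool" where
  "pos_semidef A \<longleftrightarrow> (\<forall>x \<in> carrier_vec (dim_row A). scalar_prod x (A *\<^sub>v x) \<ge> 0)"

definition pos_def :: "real mat \<Rightarrow> bool" where
  "pos_def A \<longleftrightarrow>
     (\<forall>x \<in> carrier_vec (dim_row A). x \<noteq> 0\<^sub>v (dim_row A) \<longrightarrow> scalar_prod x (A *\<^sub>v x) > 0)"

text \<open>Only applied to real symmetric matrices of positive dimension, for which the set of (real)
  eigenvalues is finite and nonempty.\<close>

definition lambda_min :: "real mat \<Rightarrow> real" where
  "lambda_min A = Min {k. eigenvalue A k}"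

definition pencil :: "quadratic \<Rightarrow> quadratic \<Rightarrow> real \<Rightarrow> real mat" where
  "pencil q0 q1 \<gamma> = qmat q0 + \<gamma> \<cdot>\<^sub>m qmat q1"

definition assumption_A :: "nat \<Rightarrow> quadratic \<Rightarrow> quadratic \<Rightarrow> bool" where
  "assumption_A n q0 q1 \<longleftrightarrow>
     qmat q0 \<in> carrier_mat n n \<and> transpose_mat (qmat q0) = qmat q0 \<and>
     qmat q1 \<in> carrier_mat n n \<and> transpose_mat (qmat q1) = qmat q1 \<and>
     qvec q0 \<in> carrier_vec n \<and> qvec q1 \<in> carrier_vec n \<and>
     (\<exists>k < 0. eigenvalue (qmat q0) k) \<and> (\<exists>k < 0. eigenvalue (qmat q1) k) \<and>
     (\<exists>\<gamma> \<ge> 0. pos_def (pencil q0 q1 \<gamma>)) \<and>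
     spectral_norm (qmat q0) \<le> 1 \<and> spectral_norm (qmat q1) \<le> 1 \<and>
     vnorm (qvec q0) \<le> 1 \<and> vnorm (qvec q1) \<le> 1 \<and> \<bar>qconst q1\<bar> \<le> 1"

definition Gamma_set :: "quadratic \<Rightarrow> quadratic \<Rightarrow> real set" where
  "Gamma_set q0 q1 = {\<gamma>. \<gamma> \<ge> 0 \<and> pos_semidef (pencil q0 q1 \<gamma>)}"

text \<open>Under \<open>assumption_A\<close> the suprema in the next two definitions are attained, so they are the
  right endpoint of the compact interval \<open>Gamma_set q0 q1\<close> and the maximum of \<open>lambda_min\<close>
  over the nonnegative half-line.\<close>

definition gamma_plus :: "quadratic \<Rightarrow> quadratic \<Rightarrow> real" where
  "gamma_plus q0 q1 = Sup (Gamma_set q0 q1)"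

definition xi_star :: "quadratic \<Rightarrow> quadratic \<Rightarrow> real" where
  "xi_star q0 q1 = min 1 (SUP \<gamma>\<in>{0..}. lambda_min (pencil q0 q1 \<gamma>))"

definition zeta_star :: "quadratic \<Rightarrow> quadratic \<Rightarrow> real" where
  "zeta_star q0 q1 = max 1 (gamma_plus q0 q1)"

definition regular_pair :: "quadratic \<Rightarrow> quadratic \<Rightarrow> real \<Rightarrow> real \<Rightarrow> bool" where
  "regular_pair q0 q1 \<xi> \<zeta> \<longleftrightarrow> 0 < \<xi> \<and> \<xi> \<le> xi_star q0 q1 \<and> \<zeta> \<ge> zeta_star q0 q1"

definition nonzeros :: "real mat \<Rightarrow> (nat \<times> nat) set" where
  "nonzeros A = {(i, j). i < dim_row A \<and> j < dim_col A \<and> A $$ (i, j) \<noteq> 0}"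

definition nnz :: "quadratic \<Rightarrow> quadratic \<Rightarrow> nat" where
  "nnz q0 q1 = card (nonzeros (qmat q0)) + card (nonzeros (qmat q1))"


section \<open>A randomized real RAM\<close>

text \<open>The machine has registers and finitely many named, unbounded, zero-initialised arrays, both
  for words (natural numbers, used for addressing and counting) and for exact real numbers; array
  names and register numbers are part of the program text. Every instruction and every test
  costs one unit of time. A real constant in a program is an integer, and there is no rounding from
  reals to words, so that the program text carries no hidden real information and the usual abuses of unit-cost
  real arithmetic with floors are excluded. Division by zero and square roots of negative
  numbers follow the conventions of HOL.

  Randomness is an infinite tape of independent uniform samples from \<open>[0, 1]\<close>; \<open>rtape\<close> is its
  unread part.\<close>

record ram =
  wreg :: "nat \<Rightarrow> nat"
  rreg :: "nat \<Rightarrow> real"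
  warr :: "nat \<Rightarrow> nat \<Rightarrow> nat"
  rarr :: "nat \<Rightarrow> nat \<Rightarrow> real"
  rtape :: "nat \<Rightarrow> real"

datatype instr =
    WConst nat nat
  | WAdd nat nat nat
  | WSub nat nat nat
  | WGet nat nat nat
  | WPut nat nat nat
  | RConst nat int
  | RCast nat nat
  | RAdd nat nat nat
  | RSub nat nat nat
  | RMul nat nat nat
  | RDiv nat nat nat
  | RSqrt nat nat
  | RGet nat nat nat
  | RPut nat nat nat
  | RRand nat

datatype test =
    WLess nat nat
  | RLess nat nat

datatype prog =
    Skip
  | Do instr
  | Seq prog prog
  | Cond test prog prog
  | While test prog

text \<open>In \<open>WGet i a j\<close> and \<open>RGet i a j\<close> cell number \<open>wreg j\<close> of array \<open>a\<close> is read into register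
  \<open>i\<close>; in \<open>WPut a j i\<close> and \<open>RPut a j i\<close> register \<open>i\<close> is written to that cell.\<close>

fun exec_instr :: "instr \<Rightarrow> ram \<Rightarrow> ram" where
  "exec_instr (WConst i c) s = s\<lparr>wreg := (wreg s)(i := c)\<rparr>"
| "exec_instr (WAdd i j k) s = s\<lparr>wreg := (wreg s)(i := wreg s j + wreg s k)\<rparr>"
| "exec_instr (WSub i j k) s = s\<lparr>wreg := (wreg s)(i := wreg s j - wreg s k)\<rparr>"
| "exec_instr (WGet i a j) s = s\<lparr>wreg := (wreg s)(i := warr s a (wreg s j))\<rparr>"
| "exec_instr (WPut a j i) s =
     s\<lparr>warr := (warr s)(a := (warr s a)(wreg s j := wreg s i))\<rparr>"
| "exec_instr (RConst i c) s = s\<lparr>rreg := (rreg s)(i := of_int c)\<rparr>"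
| "exec_instr (RCast i j) s = s\<lparr>rreg := (rreg s)(i := real (wreg s j))\<rparr>"
| "exec_instr (RAdd i j k) s = s\<lparr>rreg := (rreg s)(i := rreg s j + rreg s k)\<rparr>"
| "exec_instr (RSub i j k) s = s\<lparr>rreg := (rreg s)(i := rreg s j - rreg s k)\<rparr>"
| "exec_instr (RMul i j k) s = s\<lparr>rreg := (rreg s)(i := rreg s j * rreg s k)\<rparr>"
| "exec_instr (RDiv i j k) s = s\<lparr>rreg := (rreg s)(i := rreg s j / rreg s k)\<rparr>"
| "exec_instr (RSqrt i j) s = s\<lparr>rreg := (rreg s)(i := sqrt (rreg s j))\<rparr>"
| "exec_instr (RGet i a j) s = s\<lparr>rreg := (rreg s)(i := rarr s a (wreg s j))\<rparr>"
| "exec_instr (RPut a j i) s =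
     s\<lparr>rarr := (rarr s)(a := (rarr s a)(wreg s j := rreg s i))\<rparr>"
| "exec_instr (RRand i) s =
     s\<lparr>rreg := (rreg s)(i := rtape s 0), rtape := (\<lambda>k. rtape s (Suc k))\<rparr>"

fun eval_test :: "test \<Rightarrow> ram \<Rightarrow> bool" where
  "eval_test (WLess i j) s \<longleftrightarrow> wreg s i < wreg s j"
| "eval_test (RLess i j) s \<longleftrightarrow> rreg s i < rreg s j"

text \<open>\<open>runs c s t s'\<close>: started in \<open>s\<close>, the program \<open>c\<close> halts in \<open>s'\<close> after \<open>t\<close> time units.\<close>

inductive runs :: "prog \<Rightarrow> ram \<Rightarrow> nat \<Rightarrow> ram \<Rightarrow> bool" where
  Skip: "runs Skip s 0 s"
| Do: "runs (Do i) s 1 (exec_instr i s)"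
| Seq: "runs c s t s' \<Longrightarrow> runs d s' t' s'' \<Longrightarrow> runs (Seq c d) s (t + t') s''"
| CondTrue: "eval_test b s \<Longrightarrow> runs c s t s' \<Longrightarrow> runs (Cond b c d) s (Suc t) s'"
| CondFalse: "\<not> eval_test b s \<Longrightarrow> runs d s t s' \<Longrightarrow> runs (Cond b c d) s (Suc t) s'"
| WhileFalse: "\<not> eval_test b s \<Longrightarrow> runs (While b c) s 1 s"
| WhileTrue: "eval_test b s \<Longrightarrow> runs c s t s' \<Longrightarrow> runs (While b c) s' t' s'' \<Longrightarrow>
     runs (While b c) s (Suc (t + t')) s''"

definition tape_measure :: "(nat \<Rightarrow> real) measure" where
  "tape_measure = (\<Pi>\<^sub>M k\<in>UNIV. uniform_measure lborel {0..1})"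


section \<open>Input format\<close>

text \<open>Matrices are given as coordinate lists: their nonzero positions, in arbitrary order and
  without repetition, together with the entries at these positions.\<close>

definition coordinate_list :: "real mat \<Rightarrow> (nat \<times> nat) list \<Rightarrow> bool" where
  "coordinate_list A es \<longleftrightarrow> distinct es \<and> set es = nonzeros A"

definition cells :: "'a::zero list \<Rightarrow> nat \<Rightarrow> 'a" where
  "cells xs k = (if k < length xs then xs ! k else 0)"

definition zeta_input ::
  "nat \<Rightarrow> quadratic \<Rightarrow> quadratic \<Rightarrow> (nat \<times> nat) list \<Rightarrow> (nat \<times> nat) list \<Rightarrow>
     real \<Rightarrow> real \<Rightarrow> real \<Rightarrow> real \<Rightarrow> (nat \<Rightarrow> real) \<Rightarrow> ram" where
  "zeta_input n q0 q1 es0 es1 \<xi> \<zeta>' \<gamma>' p \<omega> =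
     \<lparr>wreg = cells [n, length es0, length es1],
      rreg = cells [qconst q0, qconst q1, \<xi>, \<zeta>', \<gamma>', p],
      warr = (\<lambda>a. cells (if a = 0 then map fst es0 else if a = 1 then map snd es0
                        else if a = 2 then map fst es1 else if a = 3 then map snd es1 else [])),
      rarr = (\<lambda>a. cells (if a = 0 then map (\<lambda>e. qmat q0 $$ e) es0
                        else if a = 1 then map (\<lambda>e. qmat q1 $$ e) es1
                        else if a = 2 then list_of_vec (qvec q0)
                        else if a = 3 then list_of_vec (qvec q1) else [])),
      rtape = \<omega>\<rparr>"

definition result :: "ram \<Rightarrow> real" where
  "result s = rreg s 0"


section \<open>Logarithms in asymptotic bounds\<close>

text \<open>As usual inside \<open>O\<close>-bounds, logarithmic factors are understood to be at least 1. Without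
  this the bound would degenerate, e.g. to time 0 when \<open>\<zeta>' = zeta_star q0 q1\<close>.\<close>

definition Log :: "real \<Rightarrow> real" where
  "Log x = max 1 (ln x)"

definition LogLog :: "real \<Rightarrow> real" where
  "LogLog x = Log (Log x)"

end

theory Submission
  imports Defs
begin

text \<open>Starting from \<open>\<gamma> = max 1 \<gamma>'\<close>, double \<open>\<gamma>\<close> until
  \<open>A(\<gamma>)\<close> is certified not to be positive
  semidefinite. For the test at \<open>\<gamma>\<close> put \<open>M = I - A(\<gamma>) / \<gamma>\<close>
    and run the Chebyshev recurrence
  \<open>u\<^sub>0 = 0\<close>, \<open>u\<^sub>1 = v\<close>, \<open>u\<^sub>k\<^sub>+\<^sub>2 = 2 M
    u\<^sub>k\<^sub>+\<^sub>1 - u\<^sub>k\<close> on one random vector \<open>v\<close>. If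
      \<open>A(\<gamma>)\<close> is positive
  semidefinite, then \<open>M\<close> is a contraction and \<open>|u\<^sub>k| \<le> k |v|\<close>, so a
    violation of this bound proves
  \<open>\<gamma> \<ge> \<gamma>\<^sub>+\<close> with certainty. If \<open>\<gamma> \<ge> 2
    \<gamma>\<^sub>+\<close>, concavity of \<open>\<lambda>\<^sub>m\<^sub>i\<^sub>n\<close> gives an
      eigenvalue at most \<open>-\<xi>\<close>, and the
  component of \<open>u\<^sub>k\<close> along its eigenvector grows like \<open>(1 + sqrt (\<xi> /
    \<gamma>))\<close> to the power \<open>k / 2\<close>; the
  bound is violated after \<open>O(sqrt (\<gamma> / \<xi>) log (n / p))\<close> steps unless
    \<open>v\<close> is almost orthogonal to it.

  Since the certificate is one-sided, only the test at the first \<open>\<gamma> \<ge> 2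
    \<gamma>\<^sub>+\<close> has to succeed, and \<open>v\<close>
  can be shared by all tests without a union bound. The costs of the tests form a geometric series.
  The program additionally stops at \<open>\<gamma> \<ge> \<zeta>'\<close>; it then halts on every tape,
    which makes the
  success event explicit and hence measurable.\<close>

section \<open>Symmetric forms and the Chebyshev recurrence\<close>

definition ip :: "nat \<Rightarrow> (nat \<Rightarrow> real) \<Rightarrow> (nat \<Rightarrow> real)
  \<Rightarrow> real" where
  "ip n x y = (\<Sum>i<n. x i * y i)"

text \<open>Vectors and matrices are functions on all of \<open>nat\<close>, read only at indices
  below \<open>n\<close>. A RAM array and the random tape are then vectors without any
  conversion.\<close>

definition mv :: "nat \<Rightarrow> (nat \<Rightarrow> nat \<Rightarrow> real) \<Rightarrow> (nat
  \<Rightarrow> real) \<Rightarrow> nat \<Rightarrow> real" where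
  "mv n a x = (\<lambda>i. \<Sum>j<n. a i j * x j)"

definition sym_upto :: "nat \<Rightarrow> (nat \<Rightarrow> nat \<Rightarrow> real) \<Rightarrow> bool" where
  "sym_upto n a \<longleftrightarrow> (\<forall>i<n. \<forall>j<n. a i j = a j i)"

lemma ip_commute: "ip n x y = ip n y x"
  by (simp add: ip_def mult.commute)

lemma ip_add [simp]:
  "ip n (\<lambda>i. x i + y i) z = ip n x z + ip n y z"
  "ip n z (\<lambda>i. x i + y i) = ip n z x + ip n z y"
  by (simp_all add: ip_def algebra_simps sum.distrib)

lemma ip_diff [simp]:
  "ip n (\<lambda>i. x i - y i) z = ip n x z - ip n y z"
  "ip n z (\<lambda>i. x i - y i) = ip n z x - ip n z y"
  by (simp_all add: ip_def algebra_simps sum_subtractf)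

lemma ip_scale [simp]:
  "ip n (\<lambda>i. c * x i) z = c * ip n x z"
  "ip n z (\<lambda>i. c * x i) = c * ip n z x"
  by (simp_all add: ip_def algebra_simps sum_distrib_left)

lemma ip_zero [simp]: "ip n (\<lambda>_. 0) x = 0" "ip n x (\<lambda>_. 0) = 0"
  by (simp_all add: ip_def)

lemma ip_self_nonneg: "0 \<le> ip n x x"
  by (simp add: ip_def sum_nonneg)

lemma ip_self_eq_0: "ip n x x = 0 \<Longrightarrow> i < n \<Longrightarrow> x i = 0"
  by (auto simp: ip_def sum_nonneg_eq_0_iff)

lemma ip_cong: "(\<And>i. i < n \<Longrightarrow> x i = x' i) \<Longrightarrow> (\<And>i. i < n
  \<Longrightarrow> y i = y' i) \<Longrightarrow> ip n x y = ip n x' y'"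
  by (simp add: ip_def)

lemma ip_Cauchy_Schwarz: "\<bar>ip n x y\<bar> \<le> sqrt (ip n x x) * sqrt (ip n y y)"
proof -
  have "\<bar>ip n x y\<bar> \<le> (\<Sum>i<n. \<bar>x i\<bar> * \<bar>y i\<bar>)"
    unfolding ip_def by (rule order.trans[OF sum_abs]) (simp add: abs_mult)
  also have "\<dots> \<le> L2_set x {..<n} * L2_set y {..<n}"
    by (rule L2_set_mult_ineq)
  finally show ?thesis by (simp add: L2_set_def ip_def power2_eq_square)
qed

lemma ip_triangle:
  "sqrt (ip n (\<lambda>i. x i + y i) (\<lambda>i. x i + y i)) \<le> sqrt (ip n x x) + sqrt (ip n y y)"
  using L2_set_triangle_ineq[of x y "{..<n}"]
  by (simp only: L2_set_def ip_def power2_eq_square)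

lemma mv_diff [simp]: "mv n a (\<lambda>i. x i - y i) = (\<lambda>i. mv n a x i - mv n a y i)"
  by (simp add: mv_def algebra_simps sum_subtractf)

lemma mv_scale [simp]: "mv n a (\<lambda>i. c * x i) = (\<lambda>i. c * mv n a x i)"
  by (simp add: mv_def algebra_simps sum_distrib_left)

lemma mv_zero [simp]: "mv n a (\<lambda>_. 0) = (\<lambda>_. 0)"
  by (simp add: mv_def)

lemma mv_cong: "(\<And>i. i < n \<Longrightarrow> x i = y i) \<Longrightarrow> mv n a x = mv n a y"
  by (simp add: mv_def)

lemma mv_sym:
  assumes "sym_upto n a" shows "ip n (mv n a x) y = ip n x (mv n a y)"
proof -
  have "ip n (mv n a x) y = (\<Sum>i<n. \<Sum>j<n. a i j * x j * y i)"
    by (simp add: ip_def mv_def sum_distrib_right)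
  also have "\<dots> = (\<Sum>j<n. \<Sum>i<n. a i j * x j * y i)" by (rule sum.swap)
  also have "\<dots> = (\<Sum>j<n. \<Sum>i<n. x j * (a j i * y i))"
    using assms by (intro sum.cong) (auto simp: sym_upto_def)
  also have "\<dots> = ip n x (mv n a y)" by (simp add: ip_def mv_def sum_distrib_left)
  finally show ?thesis .
qed

text \<open>This is a^2 \<le> c a for 0 \<le> a \<le> c, obtained by expanding the form at x - a x /
  c.\<close>

lemma psd_mv_norm_le:
  assumes a: "sym_upto n a" and psd: "\<And>x. 0 \<le> ip n x (mv n a x)"
    and le: "\<And>x. ip n x (mv n a x) \<le> c * ip n x x" and c: "c > 0"
  shows "ip n (mv n a x) (mv n a x) \<le> c * ip n x (mv n a x)"
proof -
  let ?y = "mv n a x"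
  define s where "s = 1 / c"
  have sym: "ip n x (mv n a ?y) = ip n ?y ?y" using mv_sym[OF a, of x ?y] by simp
  have s: "s * c = 1" "s > 0" using c by (simp_all add: s_def)
  have "0 \<le> ip n (\<lambda>i. x i - s * ?y i) (mv n a (\<lambda>i. x i - s * ?y i))" by (rule psd)
  also have "\<dots> = ip n x ?y - 2 * s * ip n ?y ?y + s * s * ip n ?y (mv n a ?y)"
    by (simp add: sym algebra_simps)
  also have "\<dots> \<le> ip n x ?y - 2 * s * ip n ?y ?y + s * s * (c * ip n ?y ?y)"
    using mult_left_mono[OF le[of ?y], of "s * s"] s by simp
  also have "s * s * (c * ip n ?y ?y) = s * ip n ?y ?y" using s by (simp add: algebra_simps)
  finally have "0 \<le> ip n x ?y - s * ip n ?y ?y" by simp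
  then show ?thesis using c by (simp add: s_def field_simps)
qed

text \<open>A minimiser of the form on the unit sphere is an eigenvector, because the first-order
  change of the form along the residual must vanish there.\<close>

lemma rayleigh_min:
  assumes n: "n > 0" and a: "sym_upto n a"
  shows "\<exists>x m. ip n x x = 1 \<and> (\<forall>i<n. mv n a x i = m * x i) \<and> (\<forall>y. m *
    ip n y y \<le> ip n y (mv n a y))"
proof -
  \<comment> \<open>Freezing the coordinates from \<open>n\<close> on at 0 makes the box a product
    of compact sets in the function space, so Tychonoff applies.\<close>
  define B where "B = (\<Pi>\<^sub>E i\<in>(UNIV::nat set). if i < n then {-1..1::real} else {0})"
  define S where "S = B \<inter> {x. ip n x x = 1}"
  have "compactin (product_topology (\<lambda>i. euclidean) UNIV) B"
    unfolding B_def by (subst compactin_PiE) (auto simp: compactin_euclidean_iff)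
  then have "compact B" by (simp add: euclidean_product_topology compactin_euclidean_iff)
  moreover have cont: "continuous_on UNIV (\<lambda>x. ip n x x)" "continuous_on UNIV (\<lambda>x. ip n x
    (mv n a x))"
    unfolding ip_def mv_def
    by (intro continuous_intros continuous_on_product_coordinates)+
  have "closed {x. ip n x x = 1}"
    by (rule closed_Collect_eq) (use cont in auto)
  ultimately have "compact S" unfolding S_def by (rule compact_Int_closed)
  moreover have "(\<lambda>i. if i = 0 then 1 else 0) \<in> S"
    using n by (auto simp: S_def B_def ip_def if_distrib cong: if_cong)
  then have "S \<noteq> {}" by blast
  ultimately obtain x where x: "x \<in> S"
    and min: "\<And>y. y \<in> S \<Longrightarrow> ip n x (mv n a x) \<le> ip n y (mv n a y)"
    using continuous_attains_inf[of S "\<lambda>x. ip n x (mv n a x)"] cont(2)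
    by (metis continuous_on_subset top_greatest)
  define m where "m = ip n x (mv n a x)"
  have x1: "ip n x x = 1" using x by (simp add: S_def)
  have m_le: "m * ip n y y \<le> ip n y (mv n a y)" for y
  proof (cases "ip n y y = 0")
    case True
    have "ip n y (mv n a y) = ip n (\<lambda>_. 0) (mv n a y)"
      using ip_self_eq_0[OF True] by (intro ip_cong) auto
    then show ?thesis using True by simp
  next
    case False
    define c where "c = 1 / sqrt (ip n y y)"
    have pos: "ip n y y > 0" using False ip_self_nonneg[of n y] by simp
    have c2: "c * c * ip n y y = 1" using pos by (simp add: c_def)
    define z where "z i = (if i < n then c * y i else 0)" for i
    have zip: "ip n z z = 1"
    proof -
      have "ip n z z = ip n (\<lambda>i. c * y i) (\<lambda>i. c * y i)" by (rule ip_cong) (simp_all add: z_def)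
      then show ?thesis using c2 by (simp add: mult.assoc)
    qed
    have "\<bar>z i\<bar> \<le> 1" if "i < n" for i
    proof -
      have "z i * z i \<le> ip n z z" unfolding ip_def
        by (rule member_le_sum[where f = "\<lambda>i. z i * z i"]) (use that in auto)
      then show ?thesis using zip abs_square_le_1[of "z i"] by (simp add: power2_eq_square)
    qed
    then have "z \<in> S" using zip by (auto simp: S_def B_def z_def abs_le_iff)
    then have "m \<le> ip n z (mv n a z)" unfolding m_def by (rule min)
    also have "mv n a z = mv n a (\<lambda>i. c * y i)" by (rule mv_cong) (simp add: z_def)
    also have "ip n z \<dots> = ip n (\<lambda>i. c * y i) \<dots>" by (rule ip_cong) (simp_all add: z_def)
    finally have "m \<le> c * c * ip n y (mv n a y)" by (simp add: mult.assoc)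
    then have "m * ip n y y \<le> c * c * ip n y (mv n a y) * ip n y y"
      using pos by (simp add: mult_right_mono)
    also have "\<dots> = ip n y (mv n a y)" using c2 by (simp add: algebra_simps)
    finally show ?thesis .
  qed
  define b where "b i = mv n a x i - m * x i" for i
  have b: "b = (\<lambda>i. mv n a x i - m * x i)" by (simp add: fun_eq_iff b_def)
  have "ip n b b = 0"
  proof (rule ccontr)
    assume "ip n b b \<noteq> 0"
    then have pos: "ip n b b > 0" using ip_self_nonneg[of n b] by simp
    define q where "q = ip n b (mv n a b) - m * ip n b b"
    have q0: "q \<ge> 0" using m_le[of b] by (simp add: q_def)
    \<comment> \<open>Moving from \<open>x\<close> by -s along the residual \<open>b\<close> changes
      the gap between the form and \<open>m\<close> times the squared norm from 0 to this quadratic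
      in \<open>s\<close>.\<close>
    have key: "0 \<le> - 2 * s * ip n b b + s * s * q" for s
    proof -
      have 1: "ip n b (mv n a x) - m * ip n b x = ip n b b" by (subst (4) b) simp
      have 2: "ip n x (mv n a b) = ip n b (mv n a x)" using mv_sym[OF a, of x b] by (simp add: ip_commute)
      have "0 \<le> ip n (\<lambda>i. x i - s * b i) (mv n a (\<lambda>i. x i - s * b i))
              - m * ip n (\<lambda>i. x i - s * b i) (\<lambda>i. x i - s * b i)"
        using m_le[of "\<lambda>i. x i - s * b i"] by simp
      also have "\<dots> = - 2 * s * (ip n b (mv n a x) - m * ip n b x) + s * s * q"
        by (simp add: 2 q_def x1 m_def[symmetric] ip_commute[of n x b] algebra_simps)
      finally show ?thesis by (simp add: 1)
    qed
    \<comment> \<open>Small enough for the linear term to win; \<open>q + 1\<close> in the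
      denominator because \<open>q\<close> may be 0.\<close>
    define s where "s = ip n b b / (q + 1)"
    have "s > 0" "s * q < ip n b b" using pos q0 by (simp_all add: s_def field_simps)
    then have "s * (s * q) < s * (ip n b b)" by (simp del: mult_less_cancel_left_pos add:
      mult_less_cancel_left_pos)
    then have "- 2 * s * ip n b b + s * s * q < 0" using \<open>s > 0\<close> pos by (simp add: mult.assoc)
    with key[of s] show False by simp
  qed
  then have "\<forall>i<n. mv n a x i = m * x i" using ip_self_eq_0[of n b] by (auto simp: b_def)
  with x1 m_le show ?thesis by blast
qed

text \<open>\<open>cheb n a g v k\<close> is \<open>U\<^sub>k\<^sub>-\<^sub>1(I - a / g) v\<close> for
  the Chebyshev polynomials \<open>U\<close> of the second kind.\<close>

fun cheb :: "nat \<Rightarrow> (nat \<Rightarrow> nat \<Rightarrow> real) \<Rightarrow> real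
  \<Rightarrow> (nat \<Rightarrow> real) \<Rightarrow> nat \<Rightarrow> nat \<Rightarrow> real" where
  "cheb n a g v 0 = (\<lambda>_. 0)"
| "cheb n a g v (Suc 0) = v"
| "cheb n a g v (Suc (Suc k)) =
     (\<lambda>i. 2 * (cheb n a g v (Suc k) i - inverse g * mv n a (cheb n a g v (Suc k)) i) - cheb n a g
       v k i)"

text \<open>\<open>M\<close> is a contraction: |x|^2 - |M x|^2 = (2 g <x, a x> - |a x|^2) / g^2 is
  nonnegative by \<open>psd_mv_norm_le\<close>. Passing from M u_k to u_{k+1} adds T_k(M) v, with
  T_k the Chebyshev polynomial of the first kind, and this has norm at most |v|.\<close>

lemma cheb_bounded:
  assumes a: "sym_upto n a" and psd: "\<And>x. 0 \<le> ip n x (mv n a x)"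
    and le: "\<And>x. ip n x (mv n a x) \<le> 2 * g * ip n x x" and g: "g > 0"
  shows "sqrt (ip n (cheb n a g v k) (cheb n a g v k)) \<le> real k * sqrt (ip n v v)"
proof -
  define M where "M x = (\<lambda>i. x i - inverse g * mv n a x i)" for x :: "nat \<Rightarrow> real"
  let ?u = "cheb n a g v"
  have Msym: "ip n (M x) y = ip n x (M y)" for x y by (simp add: M_def mv_sym[OF a])
  have Mle: "ip n (M x) (M x) \<le> ip n x x" for x
  proof -
    have "ip n (mv n a x) (mv n a x) \<le> 2 * g * ip n x (mv n a x)"
      by (rule psd_mv_norm_le[OF a psd le]) (use g in auto)
    then have "inverse g * (inverse g * ip n (mv n a x) (mv n a x)) \<le> inverse g * (inverse g * (2 * g
      * ip n x (mv n a x)))"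
      using g by (intro mult_left_mono) auto
    also have "\<dots> = 2 * (inverse g * ip n x (mv n a x))" using g by simp
    finally show ?thesis by (simp add: M_def mv_sym[OF a] ip_commute[of n "mv n a x" x])
  qed
  have rec: "?u (Suc (Suc k)) = (\<lambda>i. 2 * M (?u (Suc k)) i - ?u k i)" for k
    by (simp add: M_def)
  \<comment> \<open>Adding \<open>|M u\<^sub>k|\<^sup>2 - |u\<^sub>k|\<^sup>2 \<le> 0\<close> to this
    invariant bounds \<open>|u\<^sub>k\<^sub>+\<^sub>1 - M u\<^sub>k|\<close> by \<open>|v|\<close>.\<close>
  have energy: "ip n (?u (Suc k)) (?u (Suc k)) - 2 * ip n (?u (Suc k)) (M (?u k)) + ip n (?u k) (?u k)
      = ip n v v" for k
  proof (induction k)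
    case 0
    then show ?case by (simp add: M_def)
  next
    case (Suc k)
    define x y where "x = ?u k" and "y = ?u (Suc k)"
    have "ip n (M y) x = ip n y (M x)" by (rule Msym)
    moreover have "ip n (\<lambda>i. 2 * M y i - x i) (\<lambda>i. 2 * M y i - x i)
        = 4 * ip n (M y) (M y) - 4 * ip n (M y) x + ip n x x"
      by (simp add: ip_commute[of n x "M y"])
    moreover have "ip n (\<lambda>i. 2 * M y i - x i) (M y) = 2 * ip n (M y) (M y) - ip n (M y) x"
      by (simp add: ip_commute[of n x "M y"])
    moreover have "ip n y y - 2 * ip n y (M x) + ip n x x = ip n v v"
      using Suc by (simp only: x_def y_def)
    ultimately have "ip n (\<lambda>i. 2 * M y i - x i) (\<lambda>i. 2 * M y i - x i)
        - 2 * ip n (\<lambda>i. 2 * M y i - x i) (M y) + ip n y y = ip n v v"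
      by linarith
    then show ?case by (simp only: rec x_def y_def)
  qed
  have diff: "ip n (\<lambda>i. ?u (Suc k) i - M (?u k) i) (\<lambda>i. ?u (Suc k) i - M (?u k) i) \<le>
    ip n v v" for k
    using energy[of k] Mle[of "?u k"] by (simp add: ip_commute[of n "M (?u k)" "?u (Suc k)"])
  show ?thesis
  proof (induction k)
    case 0
    then show ?case by simp
  next
    case (Suc k)
    have "sqrt (ip n (?u (Suc k)) (?u (Suc k))) \<le> sqrt (ip n (M (?u k)) (M (?u k)))
      + sqrt (ip n (\<lambda>i. ?u (Suc k) i - M (?u k) i) (\<lambda>i. ?u (Suc k) i - M (?u k) i))"
      using ip_triangle[of n "M (?u k)" "\<lambda>i. ?u (Suc k) i - M (?u k) i"] by simp
    also have "\<dots> \<le> sqrt (ip n (?u k) (?u k)) + sqrt (ip n v v)"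
      using Mle diff by (intro add_mono) auto
    also have "\<dots> \<le> real (Suc k) * sqrt (ip n v v)" using Suc by (simp add: algebra_simps)
    finally show ?case .
  qed
qed

section \<open>Growth of the recurrence along an eigenvector\<close>

fun chebU :: "real \<Rightarrow> nat \<Rightarrow> real" where
  "chebU \<mu> 0 = 0"
| "chebU \<mu> (Suc 0) = 1"
| "chebU \<mu> (Suc (Suc k)) = 2 * \<mu> * chebU \<mu> (Suc k) - chebU \<mu> k"

text \<open>By symmetry, pairing with an eigenvector turns the vector recurrence into its scalar
  version.\<close>

lemma cheb_eigenvector:
  assumes a: "sym_upto n a" and u: "\<And>i. i < n \<Longrightarrow> mv n a u i = l * u i"
  shows "ip n u (cheb n a g v k) = chebU (1 - l / g) k * ip n u v"
proof (induction k rule: induct_nat_012)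
  case (ge2 k)
  have "ip n u (mv n a x) = l * ip n u x" for x
    using mv_sym[OF a, of u x] ip_cong[of n "mv n a u" "\<lambda>i. l * u i" x x] u by simp
  then show ?case using ge2 by (simp add: algebra_simps divide_inverse)
qed simp_all

text \<open>With r and 1/r the roots of z^2 - 2 \<mu> z + 1, two steps of the recurrence add r^(k+1)
  + r^-(k+1). So the value at 2j is at least r + r^3 + ... + r^(2j-1), whose j terms have geometric
  mean r^j. The factor j is kept because the bound to be violated also grows linearly.\<close>

lemma chebU_growth:
  assumes "\<mu> \<ge> 1" and r: "r = \<mu> + sqrt (\<mu>\<^sup>2 - 1)"
  shows "real j * r ^ j \<le> chebU \<mu> (2 * j)"
proof -
  have r1: "r \<ge> 1" using assms by (simp add: add_increasing2)
  define q where "q = 1 / r"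
  have q: "q > 0" "r * q = 1" using r1 by (simp_all add: q_def)
  have "\<mu>\<^sup>2 \<ge> 1" using \<open>\<mu> \<ge> 1\<close> by simp
  then have "r * (2 * \<mu> - r) = 1" by (simp add: r algebra_simps power2_eq_square)
  then have "r * (2 * \<mu> - r) = r * q" using q by simp
  then have mu: "2 * \<mu> = r + q" using r1 by simp
  have step: "chebU \<mu> (Suc (Suc k)) - chebU \<mu> k = r ^ Suc k + q ^ Suc k" for k
  proof (induction k rule: induct_nat_012)
    case 0
    then show ?case using mu by simp
  next
    case 1
    have "chebU \<mu> (Suc (Suc (Suc 0))) - chebU \<mu> (Suc 0) = (2 * \<mu>) * (2 * \<mu>) - 2" by simp
    also have "\<dots> = r * r + q * q + 2 * (r * q) - 2" unfolding mu by (simp add: algebra_simps)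
    finally show ?case using q by (simp del: chebU.simps)
  next
    case (ge2 k)
    have "chebU \<mu> (Suc (Suc (Suc (Suc k)))) - chebU \<mu> (Suc (Suc k))
      = 2 * \<mu> * (chebU \<mu> (Suc (Suc (Suc k))) - chebU \<mu> (Suc k)) - (chebU \<mu> (Suc (Suc k))
        - chebU \<mu> k)"
      by (simp add: algebra_simps)
    also have "\<dots> = (r + q) * (r ^ Suc (Suc k) + q ^ Suc (Suc k)) - (r ^ Suc k + q ^ Suc k)"
      by (simp only: ge2 mu)
    also have "\<dots> = r ^ Suc (Suc (Suc k)) + q ^ Suc (Suc (Suc k)) + (r * q) * (r ^ Suc k + q ^ Suc k)
        - (r ^ Suc k + q ^ Suc k)"
      by (simp add: algebra_simps)
    finally show ?case using q by simp
  qed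
  show ?thesis
  proof (induction j)
    case 0
    then show ?case by simp
  next
    case (Suc j)
    \<comment> \<open>Bernoulli replaces the inequality of means: it yields (j+1) r \<le> j +
      r^(j+1), the induction step divided by r^j.\<close>
    have bern: "1 + real j * (r - 1) \<le> r ^ j"
      using Bernoulli_inequality[of "r - 1" j] r1 by simp
    have "real j * (r - 1) \<le> r * (r ^ j - 1)"
    proof -
      have "real j * (r - 1) \<le> r ^ j - 1" using bern by simp
      also have "\<dots> \<le> r * (r ^ j - 1)" using r1 mult_right_mono[of 1 r "r ^ j - 1"] by simp
      finally show ?thesis .
    qed
    then have "r ^ j * (real (Suc j) * r) \<le> r ^ j * (real j + r * r ^ j)"
      using r1 by (intro mult_left_mono) (auto simp: algebra_simps)
    then have "real (Suc j) * r ^ Suc j \<le> real j * r ^ j + r ^ Suc (2 * j)"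
      by (simp add: algebra_simps power_mult power2_eq_square)
    also have "\<dots> \<le> chebU \<mu> (2 * j) + (r ^ Suc (2 * j) + q ^ Suc (2 * j))"
      using Suc q by (intro add_mono) auto
    also have "\<dots> = chebU \<mu> (2 * Suc j)" unfolding step[symmetric] by simp
    finally show ?case .
  qed
qed

text \<open>The norm of an iterate is at least its component along the unit eigenvector
  \<open>u\<close>, hence at least j R |<u, v>| by \<open>chebU_growth\<close>, which exceeds 2 j
  |v|.\<close>

lemma cheb_detects:
  assumes a: "sym_upto n a" and u: "\<And>i. i < n \<Longrightarrow> mv n a u i = l * u i" and u1: "ip n
    u u = 1"
    and l: "l \<le> - \<xi>" and xi: "\<xi> \<ge> 0" and g: "g > 0" and j: "j > 0"
    and R: "R \<le> (1 + sqrt (\<xi> / g)) ^ j"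
    and v: "2 * sqrt (ip n v v) < R * \<bar>ip n u v\<bar>"
  shows "(2 * real j)\<^sup>2 * ip n v v < ip n (cheb n a g v (2 * j)) (cheb n a g v (2 * j))"
proof -
  define \<mu> where "\<mu> = 1 - l / g"
  define r where "r = \<mu> + sqrt (\<mu>\<^sup>2 - 1)"
  have mu: "\<mu> \<ge> 1 + \<xi> / g" using divide_right_mono[OF l, of g] g by (simp add: \<mu>_def)
  then have mu1: "\<mu> \<ge> 1" using xi g by (smt (verit) divide_nonneg_pos)
  \<comment> \<open>Source of the square root in the running time: \<mu> - 1 is only guaranteed to
    be \<xi> / g, but \<mu>^2 - 1 is at least as large and enters \<open>r\<close> under a square
    root.\<close>
  have "\<mu> - 1 \<le> (\<mu> - 1) * (\<mu> + 1)" using mu1 mult_left_mono[of 1 "\<mu> + 1" "\<mu> - 1"]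
    by simp
  then have "\<xi> / g \<le> \<mu>\<^sup>2 - 1" using mu by (simp add: power2_eq_square algebra_simps)
  then have "1 + sqrt (\<xi> / g) \<le> r" using mu1 unfolding r_def by (intro add_mono real_sqrt_le_mono)
  then have "(1 + sqrt (\<xi> / g)) ^ j \<le> r ^ j" using xi g by (intro power_mono) auto
  with R have "R \<le> r ^ j" by simp
  then have "real j * R \<le> chebU \<mu> (2 * j)"
    using chebU_growth[OF mu1 r_def, of j] mult_left_mono[of R "r ^ j" "real j"] by linarith
  have "real j * (2 * sqrt (ip n v v)) < real j * (R * \<bar>ip n u v\<bar>)"
    using v j by (intro mult_strict_left_mono) auto
  also have "\<dots> = (real j * R) * \<bar>ip n u v\<bar>" by simp
  also have "\<dots> \<le> chebU \<mu> (2 * j) * \<bar>ip n u v\<bar>"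
    by (intro mult_right_mono \<open>real j * R \<le> _\<close>) auto
  also have "\<dots> \<le> \<bar>ip n u (cheb n a g v (2 * j))\<bar>"
    by (simp add: cheb_eigenvector[OF a u] abs_mult \<mu>_def mult_right_mono)
  also have "\<dots> \<le> sqrt (ip n (cheb n a g v (2 * j)) (cheb n a g v (2 * j)))"
    using ip_Cauchy_Schwarz[of n u] by (simp add: u1)
  finally have "(real j * (2 * sqrt (ip n v v)))\<^sup>2 < (sqrt (ip n (cheb n a g v (2 * j)) (cheb n a g
    v (2 * j))))\<^sup>2"
    by (intro power_strict_mono) (auto simp: ip_self_nonneg)
  then show ?thesis by (simp add: power_mult_distrib ip_self_nonneg mult.commute mult.left_commute)
qed

section \<open>Total correctness with running time for the RAM\<close>

text \<open>Lets the existential over runs in the success event be replaced by the single run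
  constructed below.\<close>

lemma runs_deterministic:
  "runs c s t s' \<Longrightarrow> runs c s u s'' \<Longrightarrow> t = u \<and> s' = s''"
proof (induction arbitrary: u s'' rule: runs.induct)
  case (Skip s)
  then show ?case by (auto elim: runs.cases)
next
  case (Do i s)
  then show ?case by (auto elim: runs.cases)
next
  case (Seq c s t s' d t' s2)
  from Seq.prems show ?case
    by (cases rule: runs.cases) (auto dest!: Seq.IH)
next
  case (CondTrue b s c t s' d)
  from CondTrue.prems CondTrue.hyps show ?case
    by (cases rule: runs.cases) (auto dest!: CondTrue.IH)
next
  case (CondFalse b s d t s' c)
  from CondFalse.prems CondFalse.hyps show ?case
    by (cases rule: runs.cases) (auto dest!: CondFalse.IH)
next
  case (WhileFalse b s c)
  from WhileFalse.prems WhileFalse.hyps show ?case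
    by (cases rule: runs.cases) auto
next
  case (WhileTrue b s c t s' t' s2)
  from WhileTrue.prems WhileTrue.hyps show ?case
    by (cases rule: runs.cases) (auto dest!: WhileTrue.IH)
qed

section \<open>Proof rules for runs within a time budget\<close>

definition halts :: "prog \<Rightarrow> ram \<Rightarrow> nat \<Rightarrow> (ram \<Rightarrow> bool)
  \<Rightarrow> bool" where
  "halts c s T Q \<longleftrightarrow> (\<exists>t s'. runs c s t s' \<and> t \<le> T \<and> Q s')"

lemma halts_weaken:
  "halts c s T Q \<Longrightarrow> T \<le> T' \<Longrightarrow> (\<And>s'. Q s' \<Longrightarrow> Q' s')
    \<Longrightarrow> halts c s T' Q'"
  unfolding halts_def by (meson le_trans)

lemma halts_Do: "Q (exec_instr i s) \<Longrightarrow> 1 \<le> T \<Longrightarrow> halts (Do i) s T Q"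
  unfolding halts_def using runs.Do by blast

lemma halts_Seq:
  assumes "halts c s T Q" and "\<And>s'. Q s' \<Longrightarrow> halts d s' T' Q'"
  shows "halts (Seq c d) s (T + T') Q'"
  using assms unfolding halts_def by (meson add_mono runs.Seq)

lemma halts_Cond:
  assumes "eval_test b s \<Longrightarrow> halts c s T Q" and "\<not> eval_test b s \<Longrightarrow>
    halts d s T Q"
  shows "halts (Cond b c d) s (Suc T) Q"
  using assms unfolding halts_def by (metis Suc_le_mono runs.CondFalse runs.CondTrue)

text \<open>The invariant is indexed by the round and the number of rounds is known in advance, so
  different budgets \<open>T k\<close> simply add up; the doubling search relies on this for its
  geometric total. The outer \<open>Suc\<close> pays for the final failing test.\<close>

lemma halts_While:
  assumes body: "\<And>k s. k < K \<Longrightarrow> I k s \<Longrightarrow> eval_test b s \<and> halts c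
    s (T k) (I (Suc k))"
    and exit: "\<And>s. I K s \<Longrightarrow> \<not> eval_test b s" and "I 0 s"
  shows "halts (While b c) s (Suc (\<Sum>k<K. Suc (T k))) (I K)"
proof -
  have "k \<le> K \<Longrightarrow> I k s \<Longrightarrow> halts (While b c) s (Suc (\<Sum>j=k..<K. Suc
    (T j))) (I K)" for k s
  proof (induction "K - k" arbitrary: k s)
    case 0
    then show ?case using exit[of s] runs.WhileFalse[of b s c] by (auto simp: halts_def)
  next
    case (Suc d)
    then have k: "k < K" by simp
    from body[OF k Suc.prems(2)] obtain t s' where
      1: "eval_test b s" "runs c s t s'" "t \<le> T k" "I (Suc k) s'"
      by (auto simp: halts_def)
    have d: "d = K - Suc k" using Suc.hyps(2) by simp
    from Suc.hyps(1)[OF d _ 1(4)] k obtain t' s'' where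
      2: "runs (While b c) s' t' s''" "t' \<le> Suc (\<Sum>j=Suc k..<K. Suc (T j))" "I K s''"
      by (auto simp: halts_def)
    have "runs (While b c) s (Suc (t + t')) s''" by (rule runs.WhileTrue[OF 1(1,2) 2(1)])
    moreover have "Suc (t + t') \<le> Suc (\<Sum>j=k..<K. Suc (T j))"
      using 1(3) 2(2) k by (simp add: sum.atLeast_Suc_lessThan)
    ultimately show ?case using 2(3) by (auto simp: halts_def)
  qed
  from this[of 0 s] \<open>I 0 s\<close> show ?thesis by (simp add: atLeast0LessThan)
qed

definition block :: "instr list \<Rightarrow> prog" where
  "block is = foldr (\<lambda>i. Seq (Do i)) is Skip"

lemma runs_block: "runs (block is) s (length is) (fold exec_instr is s)"
proof (induction "is" arbitrary: s)
  case Nil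
  then show ?case by (simp add: block_def runs.Skip)
next
  case (Cons i "is")
  show ?case using runs.Seq[OF runs.Do Cons[of "exec_instr i s"]] by (simp add: block_def)
qed

lemma halts_block: "Q (fold exec_instr is s) \<Longrightarrow> length is \<le> T \<Longrightarrow> halts
  (block is) s T Q"
  unfolding halts_def using runs_block by blast

text \<open>Word register 3 is the index of every counting loop, and word register 6 holds the constant
  1.\<close>

definition for_loop :: "nat \<Rightarrow> instr list \<Rightarrow> prog" where
  "for_loop c is = Seq (Do (WConst 3 0)) (While (WLess 3 c) (block is))"

text \<open>The 2 pays for resetting the index and for the last test; every round pays one extra
  unit for its own test.\<close>

lemma halts_for_loop:
  assumes step: "\<And>k s'. k < m \<Longrightarrow> I k s' \<Longrightarrow> I (Suc k) (fold exec_instr is s')"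
    and idx: "\<And>k s'. I k s' \<Longrightarrow> wreg s' 3 = k \<and> wreg s' c = m"
    and init: "I 0 (exec_instr (WConst 3 0) s)"
  shows "halts (for_loop c is) s (2 + m * Suc (length is)) (I m)"
proof -
  let ?s = "exec_instr (WConst 3 0) s"
  have "halts (While (WLess 3 c) (block is)) ?s (Suc (\<Sum>k<m. Suc (length is))) (I m)"
  proof (rule halts_While)
    show "eval_test (WLess 3 c) s' \<and> halts (block is) s' (length is) (I (Suc k))"
      if "k < m" "I k s'" for k s'
      using step[OF that] idx[OF that(2)] that(1) by (auto intro: halts_block)
    show "\<not> eval_test (WLess 3 c) s'" if "I m s'" for s'
      using idx[OF that] by simp
  qed (rule init)
  then have "halts (for_loop c is) s (1 + (Suc (\<Sum>k<m. Suc (length is)))) (I m)"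
    unfolding for_loop_def by (intro halts_Seq[OF halts_Do[where Q = "\<lambda>s'. s' = ?s"]]) auto
  then show ?thesis by simp
qed

text \<open>Only the listed registers and real arrays may differ; the tape is not constrained.\<close>

definition frame :: "nat set \<Rightarrow> nat set \<Rightarrow> nat set \<Rightarrow> ram \<Rightarrow>
  ram \<Rightarrow> bool" where
  "frame W R A s s' \<longleftrightarrow> (\<forall>i. i \<notin> W \<longrightarrow> wreg s' i = wreg s
    i) \<and> (\<forall>i. i \<notin> R \<longrightarrow> rreg s' i = rreg s i) \<and>
     warr s' = warr s \<and> (\<forall>a. a \<notin> A \<longrightarrow> rarr s' a = rarr s a)"

lemma frame_refl: "frame W R A s s"
  by (simp add: frame_def)

lemma frame_trans: "frame W R A s s' \<Longrightarrow> frame W R A s' s'' \<Longrightarrow> frame W R A s s''"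
  by (simp add: frame_def)

lemma frame_mono: "frame W R A s s' \<Longrightarrow> W \<subseteq> W' \<Longrightarrow> R \<subseteq> R'
  \<Longrightarrow> A \<subseteq> A' \<Longrightarrow> frame W' R' A' s s'"
  unfolding frame_def by blast

section \<open>Subroutines on vectors and coordinate lists\<close>

definition sum_squares :: "nat \<Rightarrow> nat \<Rightarrow> prog" where
  "sum_squares a r = for_loop 0 [RGet 15 a 3, RMul 15 15 15, RAdd r r 15, WAdd 3 3 6]"

lemma halts_sum_squares:
  assumes "wreg s 0 = n" "wreg s 6 = 1" "rreg s r = 0" "r \<noteq> 15"
  shows "halts (sum_squares a r) s (2 + n * 5)
    (\<lambda>s'. frame {3} {r, 15} {} s s' \<and> rreg s' r = ip n (rarr s a) (rarr s a))"
proof -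
  let ?I = "\<lambda>k s'. wreg s' 3 = k \<and> frame {3} {r, 15} {} s s' \<and> rreg s' r = ip k (rarr s
    a) (rarr s a)"
  have "halts (sum_squares a r) s (2 + n * Suc (length [RGet 15 a 3, RMul 15 15 15, RAdd r r 15, WAdd 3 3
    6])) (?I n)"
    unfolding sum_squares_def
    by (rule halts_for_loop) (use assms in \<open>auto simp: frame_def ip_def\<close>)
  then show ?thesis by (rule halts_weaken) auto
qed

definition reflect :: "nat \<Rightarrow> nat \<Rightarrow> prog" where
  "reflect dst src = for_loop 0
     [RGet 15 src 3, RAdd 15 15 15, RGet 16 dst 3, RSub 15 15 16, RPut dst 3 15, WAdd 3 3 6]"

lemma halts_reflect:
  assumes "wreg s 0 = n" "wreg s 6 = 1" "dst \<noteq> src"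
  shows "halts (reflect dst src) s (2 + n * 7)
    (\<lambda>s'. frame {3, 4, 5} {15, 16} {dst} s s' \<and>
       (\<forall>i<n. rarr s' dst i = 2 * rarr s src i - rarr s dst i))"
proof -
  let ?I = "\<lambda>k s'. wreg s' 3 = k \<and> frame {3, 4, 5} {15, 16} {dst} s s' \<and>
       rarr s' dst = (\<lambda>i. if i < k then 2 * rarr s src i - rarr s dst i else rarr s dst i)"
  have "halts (reflect dst src) s (2 + n * Suc (length [RGet 15 src 3, RAdd 15 15 15, RGet 16 dst 3,
      RSub 15 15 16, RPut dst 3 15, WAdd 3 3 6])) (?I n)"
    unfolding reflect_def
    by (rule halts_for_loop) (use assms in \<open>auto simp: frame_def fun_eq_iff less_Suc_eq\<close>)
  then show ?thesis by (rule halts_weaken) auto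
qed

definition coo_mv :: "nat \<Rightarrow> (nat \<Rightarrow> nat) \<Rightarrow> (nat \<Rightarrow> nat)
  \<Rightarrow> (nat \<Rightarrow> real) \<Rightarrow> (nat \<Rightarrow> real) \<Rightarrow> nat
    \<Rightarrow> real" where
  "coo_mv m r c w x i = (\<Sum>l<m. if r l = i then w l * x (c l) else 0)"

definition scatter :: "nat \<Rightarrow> nat \<Rightarrow> nat \<Rightarrow> nat \<Rightarrow> nat
  \<Rightarrow> nat \<Rightarrow> nat \<Rightarrow> prog" where
  "scatter c ra ca va q dst src = for_loop c
     [WGet 4 ra 3, WGet 5 ca 3, RGet 15 va 3, RGet 16 src 5, RMul 15 15 16, RMul 15 q 15,
      RGet 16 dst 4, RSub 16 16 15, RPut dst 4 16, WAdd 3 3 6]"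

lemma halts_scatter:
  assumes "wreg s c = m" "wreg s 6 = 1" "dst \<noteq> src" "dst \<noteq> va" "c \<notin> {3, 4, 5}" "q
    \<notin> {15, 16}"
  shows "halts (scatter c ra ca va q dst src) s (2 + m * 11)
    (\<lambda>s'. frame {3, 4, 5} {15, 16} {dst} s s' \<and>
       (\<forall>i. rarr s' dst i = rarr s dst i - rreg s q *
          coo_mv m (warr s ra) (warr s ca) (rarr s va) (rarr s src) i))"
proof -
  let ?I = "\<lambda>k s'. wreg s' 3 = k \<and> frame {3, 4, 5} {15, 16} {dst} s s' \<and>
       (\<forall>i. rarr s' dst i = rarr s dst i - rreg s q *
          coo_mv k (warr s ra) (warr s ca) (rarr s va) (rarr s src) i)"
  have "halts (scatter c ra ca va q dst src) s (2 + m * Suc (length [WGet 4 ra 3, WGet 5 ca 3, RGet 15 va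
    3, RGet 16 src 5, RMul 15 15 16, RMul 15 q 15,
      RGet 16 dst 4, RSub 16 16 15, RPut dst 4 16, WAdd 3 3 6])) (?I m)"
    unfolding scatter_def
    by (rule halts_for_loop) (use assms in \<open>auto simp: frame_def coo_mv_def algebra_simps\<close>)
  then show ?thesis by (rule halts_weaken) auto
qed

text \<open>The format is specified through the products it computes, because the program accesses
  the matrices in no other way.\<close>

definition coo :: "nat \<Rightarrow> (nat \<Rightarrow> nat) \<Rightarrow> (nat \<Rightarrow> nat)
  \<Rightarrow> (nat \<Rightarrow> real) \<Rightarrow> nat \<Rightarrow> (nat \<Rightarrow> nat
    \<Rightarrow> real) \<Rightarrow> bool" where
  "coo m r c w n a \<longleftrightarrow> (\<forall>x. \<forall>i<n. coo_mv m r c w x i = mv n a x i)"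

definition ready :: "nat \<Rightarrow> nat \<Rightarrow> nat \<Rightarrow> (nat \<Rightarrow> nat
  \<Rightarrow> real) \<Rightarrow> (nat \<Rightarrow> nat \<Rightarrow> real) \<Rightarrow> ram
    \<Rightarrow> bool" where
  "ready n N0 N1 a0 a1 s \<longleftrightarrow> wreg s 0 = n \<and> wreg s 1 = N0 \<and> wreg s 2 = N1
    \<and> wreg s 6 = 1 \<and>
     rreg s 20 = 2 \<and> coo N0 (warr s 0) (warr s 1) (rarr s 0) n a0 \<and>
     coo N1 (warr s 2) (warr s 3) (rarr s 1) n a1"

lemma ready_frame:
  assumes rdy: "ready n N0 N1 a0 a1 s" and F: "frame W R A s s'"
    and "W \<subseteq> {3, 4, 5}" "20 \<notin> R" "A \<inter> {0, 1} = {}"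
  shows "ready n N0 N1 a0 a1 s'"
proof -
  have "0 \<notin> W" "1 \<notin> W" "2 \<notin> W" "6 \<notin> W" "0 \<notin> A" "1 \<notin> A" using
    assms by auto
  then have "wreg s' 0 = wreg s 0" "wreg s' 1 = wreg s 1" "wreg s' 2 = wreg s 2" "wreg s' 6 = wreg s 6"
    "warr s' = warr s" "rarr s' 0 = rarr s 0" "rarr s' 1 = rarr s 1" "rreg s' 20 = rreg s 20"
    using F \<open>20 \<notin> R\<close> by (auto simp: frame_def)
  then show ?thesis using rdy by (simp add: ready_def)
qed

definition comb :: "(nat \<Rightarrow> nat \<Rightarrow> real) \<Rightarrow> (nat \<Rightarrow> nat
  \<Rightarrow> real) \<Rightarrow> real \<Rightarrow> nat \<Rightarrow> nat \<Rightarrow> real" where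
  "comb a0 a1 g i j = a0 i j + g * a1 i j"

lemma mv_comb: "mv n (comb a0 a1 g) x i = mv n a0 x i + g * mv n a1 x i"
  by (simp add: mv_def comb_def algebra_simps sum.distrib sum_distrib_left)

text \<open>One recurrence step in place: \<open>dst := 2 M src - dst\<close>, where real register 17
  holds \<open>2 / \<gamma>\<close> and 20 holds 2.\<close>

definition cheb_step :: "nat \<Rightarrow> nat \<Rightarrow> prog" where
  "cheb_step dst src = Seq (reflect dst src) (Seq (scatter 1 0 1 0 17 dst src) (scatter 2 2 3 1 20 dst src))"

text \<open>Since (2/\<gamma>) (A0 + \<gamma> A1) = (2/\<gamma>) A0 + 2 A1, the pencil is never
  assembled: two scatters with these factors subtract its product from the reflected vector.\<close>

lemma halts_cheb_step:
  assumes rdy: "ready n N0 N1 a0 a1 s" and n: "n > 0"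
    and arr: "dst \<noteq> src" "dst \<notin> {0, 1}" and r: "rreg s 17 = 2 / g" and g: "g > 0"
  shows "halts (cheb_step dst src) s (17 * (n + N0 + N1))
    (\<lambda>s'. frame {3, 4, 5} {15, 16} {dst} s s' \<and>
       (\<forall>i<n. rarr s' dst i = 2 * (rarr s src i - inverse g * mv n (comb a0 a1 g) (rarr s src) i)
         - rarr s dst i))"
proof -
  let ?F = "frame {3, 4, 5} {15, 16} {dst}"
  let ?x = "rarr s src"
  have "halts (cheb_step dst src) s ((2 + n * 7) + ((2 + N0 * 11) + (2 + N1 * 11)))
    (\<lambda>s'. ?F s s' \<and> (\<forall>i<n. rarr s' dst i = 2 * ?x i - rarr s dst i - 2 / g * mv n a0
      ?x i - 2 * mv n a1 ?x i))"
    unfolding cheb_step_def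
  proof (rule halts_Seq, rule halts_reflect)
    show "wreg s 0 = n" "wreg s 6 = 1" using rdy by (auto simp: ready_def)
    show "dst \<noteq> src" by fact
    fix s1 assume s1: "?F s s1 \<and> (\<forall>i<n. rarr s1 dst i = 2 * ?x i - rarr s dst i)"
    then have rdy1: "ready n N0 N1 a0 a1 s1" using ready_frame[OF rdy, of _ _ _ s1] arr by auto
    have x1: "rarr s1 src = ?x" "rreg s1 17 = 2 / g" using s1 arr r by (auto simp: frame_def)
    show "halts (Seq (scatter 1 0 1 0 17 dst src) (scatter 2 2 3 1 20 dst src)) s1 ((2 + N0 * 11) + (2 +
      N1 * 11))
      (\<lambda>s'. ?F s s' \<and> (\<forall>i<n. rarr s' dst i = 2 * ?x i - rarr s dst i - 2 / g * mv n
        a0 ?x i - 2 * mv n a1 ?x i))"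
    proof (rule halts_Seq, rule halts_scatter)
      show "wreg s1 1 = N0" "wreg s1 6 = 1" using rdy1 by (auto simp: ready_def)
      fix s2 assume s2: "?F s1 s2 \<and>
       (\<forall>i. rarr s2 dst i = rarr s1 dst i - rreg s1 17 *
          coo_mv N0 (warr s1 0) (warr s1 1) (rarr s1 0) (rarr s1 src) i)"
      then have rdy2: "ready n N0 N1 a0 a1 s2" using ready_frame[OF rdy1, of _ _ _ s2] arr by auto
      have x2: "rarr s2 src = ?x" using s2 x1 arr by (auto simp: frame_def)
      have d2: "rarr s2 dst i = 2 * ?x i - rarr s dst i - 2 / g * mv n a0 ?x i" if "i < n" for i
        using s1 s2 rdy1 that by (simp add: x1 ready_def coo_def del: One_nat_def)
      show "halts (scatter 2 2 3 1 20 dst src) s2 (2 + N1 * 11)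
       (\<lambda>s'. ?F s s' \<and> (\<forall>i<n. rarr s' dst i = 2 * ?x i - rarr s dst i - 2 / g * mv n
         a0 ?x i - 2 * mv n a1 ?x i))"
      proof (rule halts_weaken[OF halts_scatter])
        show "wreg s2 2 = N1" "wreg s2 6 = 1" using rdy2 by (auto simp: ready_def)
        fix s3 assume s3: "?F s2 s3 \<and>
         (\<forall>i. rarr s3 dst i = rarr s2 dst i - rreg s2 20 *
          coo_mv N1 (warr s2 2) (warr s2 3) (rarr s2 1) (rarr s2 src) i)"
        then have "rarr s3 dst i = rarr s2 dst i - 2 * mv n a1 ?x i" if "i < n" for i
          using rdy2 that by (simp add: x2 ready_def coo_def del: One_nat_def)
        moreover have "?F s s3" using s1 s2 s3 by (blast intro: frame_trans)
        ultimately show "?F s s3 \<and> (\<forall>i<n. rarr s3 dst i =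
            2 * ?x i - rarr s dst i - 2 / g * mv n a0 ?x i - 2 * mv n a1 ?x i)"
          using d2 by simp
      qed (use arr in auto)
    qed (use arr in auto)
  qed
  then show ?thesis
  proof (rule halts_weaken)
    show "(2 + n * 7) + ((2 + N0 * 11) + (2 + N1 * 11)) \<le> 17 * (n + N0 + N1)" using n by simp
  qed (use g in \<open>auto simp: mv_comb field_simps\<close>)
qed

text \<open>Two steps per round avoid swapping arrays. There is no logarithm instruction; instead real
  register 10 accumulates \<open>(1 + sqrt (\<xi> / \<gamma>)) ^ j\<close> until it reaches the threshold
    \<open>4 n / p\<close> in 11.\<close>

definition cheb_loop :: prog where
  "cheb_loop = While (RLess 10 11)
     (Seq (cheb_step 6 5) (Seq (cheb_step 5 6) (block [RMul 10 10 9, RAdd 12 12 20])))"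

lemma halts_cheb_loop:
  assumes rdy: "ready n N0 N1 a0 a1 s" and n: "n > 0" and r: "rreg s 17 = 2 / g" and g: "g > 0"
    and init: "rreg s 9 = \<rho>" "rreg s 10 = 1" "rreg s 11 = R" "rreg s 12 = 0"
      "\<And>i. i < n \<Longrightarrow> rarr s 6 i = 0" "\<And>i. i < n \<Longrightarrow> rarr s 5 i = v i"
    and J: "\<And>j. j < J \<Longrightarrow> \<rho> ^ j < R" "R \<le> \<rho> ^ J"
  shows "halts cheb_loop s (1 + J * (37 * (n + N0 + N1)))
    (\<lambda>s'. frame {3, 4, 5} {10, 12, 15, 16} {5, 6} s s' \<and> rreg s' 12 = 2 * real J \<and>
       (\<forall>i<n. rarr s' 6 i = cheb n (comb a0 a1 g) g v (2 * J) i))"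
proof -
  let ?F = "frame {3, 4, 5} {10, 12, 15, 16} {5, 6}"
  let ?u = "cheb n (comb a0 a1 g) g v"
  let ?S = "n + N0 + N1"
  \<comment> \<open>Each array holds iterates of one parity, and a step in place advances it by two
    indices with the help of the other array.\<close>
  define I where "I j s' \<longleftrightarrow> ?F s s' \<and> rreg s' 10 = \<rho> ^ j \<and> rreg s' 12 =
    2 * real j \<and>
    (\<forall>i<n. rarr s' 6 i = ?u (2 * j) i) \<and> (\<forall>i<n. rarr s' 5 i = ?u (Suc (2 * j)) i)" for j s'
  have "halts cheb_loop s (Suc (\<Sum>k<J. Suc (17 * ?S + (17 * ?S + 2)))) (I J)"
    unfolding cheb_loop_def
  proof (rule halts_While)
    fix j s1 assume j: "j < J" and I: "I j s1"
    have F1: "?F s s1" using I by (simp add: I_def)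
    have rdy1: "ready n N0 N1 a0 a1 s1" using ready_frame[OF rdy F1] by auto
    have regs: "rreg s1 9 = \<rho>" "rreg s1 11 = R" "rreg s1 17 = 2 / g"
      using F1 init r by (auto simp: frame_def)
    have "halts (Seq (cheb_step 6 5) (Seq (cheb_step 5 6) (block [RMul 10 10 9, RAdd 12 12 20]))) s1
      (17 * ?S + (17 * ?S + 2)) (I (Suc j))"
    proof (rule halts_Seq, rule halts_cheb_step[OF rdy1 n _ _ regs(3) g])
      fix s2 assume s2: "frame {3, 4, 5} {15, 16} {6} s1 s2 \<and>
       (\<forall>i<n. rarr s2 6 i = 2 * (rarr s1 5 i - inverse g * mv n (comb a0 a1 g) (rarr s1 5) i) -
         rarr s1 6 i)"
      have rdy2: "ready n N0 N1 a0 a1 s2" using ready_frame[OF rdy1] s2 by auto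
      have F2: "?F s1 s2" using s2 by (auto intro: frame_mono)
      have r2: "rreg s2 17 = 2 / g" using s2 regs by (auto simp: frame_def)
      have x2: "rarr s2 5 = rarr s1 5" using s2 by (simp add: frame_def)
      have m1: "mv n (comb a0 a1 g) (rarr s1 5) = mv n (comb a0 a1 g) (?u (Suc (2 * j)))"
        using I by (intro mv_cong) (auto simp: I_def)
      have z2: "rarr s2 6 i = ?u (Suc (Suc (2 * j))) i" if "i < n" for i
        using s2 that I m1 by (simp add: I_def)
      show "halts (Seq (cheb_step 5 6) (block [RMul 10 10 9, RAdd 12 12 20])) s2 (17 * ?S + 2) (I (Suc j))"
      proof (rule halts_Seq, rule halts_cheb_step[OF rdy2 n _ _ r2 g])
        fix s3 assume s3: "frame {3, 4, 5} {15, 16} {5} s2 s3 \<and>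
         (\<forall>i<n. rarr s3 5 i = 2 * (rarr s2 6 i - inverse g * mv n (comb a0 a1 g) (rarr s2 6) i) -
           rarr s2 5 i)"
        have F3: "?F s2 s3" using s3 by (auto intro: frame_mono)
        have m2: "mv n (comb a0 a1 g) (rarr s2 6) = mv n (comb a0 a1 g) (?u (Suc (Suc (2 * j))))"
          using z2 by (intro mv_cong) auto
        have x3: "rarr s3 5 i = ?u (Suc (Suc (Suc (2 * j)))) i" if "i < n" for i
        proof -
          have "rarr s3 5 i = 2 * (rarr s2 6 i - inverse g * mv n (comb a0 a1 g) (rarr s2 6) i) - rarr s2 5 i"
            using s3 that by blast
          also have "rarr s2 5 i = ?u (Suc (2 * j)) i" using x2 I that by (simp add: I_def)
          finally show ?thesis unfolding m2 z2[OF that] by (subst cheb.simps(3))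
        qed
        have z3: "rarr s3 6 i = ?u (Suc (Suc (2 * j))) i" if "i < n" for i
          using z2[OF that] s3 by (simp add: frame_def)
        have "?F s s3" using F1 F2 F3 by (blast intro: frame_trans)
        moreover have "rreg s3 9 = \<rho>" "rreg s3 20 = 2" "rreg s3 10 = \<rho> ^ j" "rreg s3 12 = 2 * real j"
          using s2 s3 regs I rdy1 by (auto simp: frame_def I_def ready_def)
        ultimately show "halts (block [RMul 10 10 9, RAdd 12 12 20]) s3 2 (I (Suc j))"
          using x3 z3 by (intro halts_block) (auto simp: I_def frame_def simp del: cheb.simps)
      qed auto
    qed auto
    then show "eval_test (RLess 10 11) s1 \<and> halts (Seq (cheb_step 6 5) (Seq (cheb_step 5 6)
      (block [RMul 10 10 9, RAdd 12 12 20]))) s1 (17 * ?S + (17 * ?S + 2)) (I (Suc j))"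
      using J(1)[OF j] I regs by (simp add: I_def)
  next
    fix s1 assume "I J s1"
    then show "\<not> eval_test (RLess 10 11) s1" using J(2) init by (simp add: I_def frame_def)
  next
    show "I 0 s" using init by (simp add: I_def frame_refl)
  qed
  then show ?thesis
  proof (rule halts_weaken)
    have "Suc (17 * ?S + (17 * ?S + 2)) \<le> 37 * ?S" using n by simp
    then have "J * Suc (17 * ?S + (17 * ?S + 2)) \<le> J * (37 * ?S)" by (rule mult_le_mono2)
    then show "Suc (\<Sum>k<J. Suc (17 * ?S + (17 * ?S + 2))) \<le> 1 + J * (37 * ?S)"
      by simp
  qed (simp add: I_def)
qed

section \<open>The program\<close>

text \<open>The negation of the bound in \<open>cheb_bounded\<close> at index \<open>2 * j\<close>,
  squared so that the machine compares sums of squares.\<close>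

definition certificate :: "nat \<Rightarrow> (nat \<Rightarrow> nat \<Rightarrow> real) \<Rightarrow>
  real \<Rightarrow> nat \<Rightarrow> (nat \<Rightarrow> real) \<Rightarrow> bool" where
  "certificate n a g j v \<longleftrightarrow>
     (2 * real j)\<^sup>2 * ip n v v < ip n (cheb n a g v (2 * j)) (cheb n a g v (2 * j))"

text \<open>Real registers: 0 the current \<open>\<gamma>\<close>, 8 the stop flag, 12 the step count and
  then the squared bound,
  13 and 14 the squared norms of the start vector and of the last iterate. Real arrays: 4 the start
  vector, 5 and 6 the two latest iterates, with even index in 6.\<close>

definition zeta_test :: prog where
  "zeta_test =
     Seq (block [RDiv 17 20 0, RDiv 9 2 0, RSqrt 9 9, RAdd 9 7 9, RConst 10 1, RConst 12 0, RConst 14 0])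
    (Seq (for_loop 0 [RGet 15 4 3, RPut 5 3 15, RSub 15 15 15, RPut 6 3 15, WAdd 3 3 6])
    (Seq cheb_loop
    (Seq (sum_squares 6 14)
    (Seq (block [RMul 12 12 12, RMul 12 12 13])
         (Cond (RLess 12 14) (Do (RConst 8 1))
            (Cond (RLess 0 3) (Do (RAdd 0 0 0)) (Do (RConst 8 1))))))))"

text \<open>\<open>J\<close> is determined by the threshold alone, so the budget of one test does
  not depend on the random vector.\<close>

lemma halts_zeta_test:
  assumes rdy: "ready n N0 N1 a0 a1 s" and n: "n > 0" and g: "g > 0"
    and regs: "rreg s 0 = g" "rreg s 2 = \<xi>" "rreg s 3 = \<zeta>" "rreg s 7 = 1" "rreg s 8 = 0"
      "rreg s 11 = R" "rreg s 13 = ip n v v"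
    and v: "\<And>i. i < n \<Longrightarrow> rarr s 4 i = v i"
    and J: "\<And>j. j < J \<Longrightarrow> (1 + sqrt (\<xi> / g)) ^ j < R" "R \<le> (1 + sqrt (\<xi> /
      g)) ^ J" "J > 0"
  shows "halts zeta_test s (65 * J * (n + N0 + N1))
    (\<lambda>s'. frame {3, 4, 5} {0, 8, 9, 10, 12, 14, 15, 16, 17} {5, 6} s s' \<and>
       (if certificate n (comb a0 a1 g) g J v \<or> \<zeta> \<le> g then rreg s' 8 = 1 \<and> rreg s' 0 = g
        else rreg s' 8 = 0 \<and> rreg s' 0 = g + g))"
proof -
  let ?F = "frame {3, 4, 5} {0, 8, 9, 10, 12, 14, 15, 16, 17} {5, 6}"
  let ?S = "n + N0 + N1"
  let ?\<rho> = "1 + sqrt (\<xi> / g)"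
  let ?u = "cheb n (comb a0 a1 g) g v"
  let ?Q = "\<lambda>s'. ?F s s' \<and> (if certificate n (comb a0 a1 g) g J v \<or> \<zeta> \<le> g
    then rreg s' 8 = 1 \<and> rreg s' 0 = g else rreg s' 8 = 0 \<and> rreg s' 0 = g + g)"
  have "halts zeta_test s (7 + ((2 + n * 6) + ((1 + J * (37 * ?S)) + ((2 + n * 5) + (2 + Suc (Suc 1)))))) ?Q"
    unfolding zeta_test_def
  proof (rule halts_Seq[where Q = "\<lambda>s1. ?F s s1 \<and> rreg s1 0 = g \<and> rreg s1 8 = 0 \<and>
    rreg s1 17 = 2 / g \<and>
        rreg s1 9 = ?\<rho> \<and> rreg s1 10 = 1 \<and> rreg s1 12 = 0 \<and> rreg s1 14 = 0"])
    show "halts (block [RDiv 17 20 0, RDiv 9 2 0, RSqrt 9 9, RAdd 9 7 9, RConst 10 1, RConst 12 0, RConst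
      14 0]) s 7
      (\<lambda>s1. ?F s s1 \<and> rreg s1 0 = g \<and> rreg s1 8 = 0 \<and> rreg s1 17 = 2 / g \<and>
        rreg s1 9 = ?\<rho> \<and> rreg s1 10 = 1 \<and> rreg s1 12 = 0 \<and> rreg s1 14 = 0)"
      using regs rdy by (intro halts_block) (auto simp: frame_def ready_def)
  next
    fix s1 assume s1: "?F s s1 \<and> rreg s1 0 = g \<and> rreg s1 8 = 0 \<and> rreg s1 17 = 2 / g \<and>
        rreg s1 9 = ?\<rho> \<and> rreg s1 10 = 1 \<and> rreg s1 12 = 0 \<and> rreg s1 14 = 0"
    have rdy1: "ready n N0 N1 a0 a1 s1" using ready_frame[OF rdy] s1 by auto
    have v1: "rarr s1 4 i = v i" if "i < n" for i using s1 v that by (simp add: frame_def)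
    let ?G = "frame {3} {15} {5, 6}"
    let ?I = "\<lambda>k s'. wreg s' 3 = k \<and> ?G s1 s' \<and> (\<forall>i<k. rarr s' 6 i = 0) \<and>
      (\<forall>i<k. rarr s' 5 i = rarr s1 4 i)"
    have "halts (for_loop 0 [RGet 15 4 3, RPut 5 3 15, RSub 15 15 15, RPut 6 3 15, WAdd 3 3 6]) s1
       (2 + n * Suc (length [RGet 15 4 3, RPut 5 3 15, RSub 15 15 15, RPut 6 3 15, WAdd 3 3 6])) (?I n)"
      by (rule halts_for_loop) (use rdy1 in \<open>auto simp: frame_def ready_def less_Suc_eq\<close>)
    then have loop1: "halts (for_loop 0 [RGet 15 4 3, RPut 5 3 15, RSub 15 15 15, RPut 6 3 15, WAdd 3 3 6]) s1
       (2 + n * 6) (?I n)" by (rule halts_weaken) auto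
    show "halts (Seq (for_loop 0 [RGet 15 4 3, RPut 5 3 15, RSub 15 15 15, RPut 6 3 15, WAdd 3 3 6])
      (Seq cheb_loop (Seq (sum_squares 6 14) (Seq (block [RMul 12 12 12, RMul 12 12 13])
       (Cond (RLess 12 14) (Do (RConst 8 1)) (Cond (RLess 0 3) (Do (RAdd 0 0 0)) (Do (RConst 8 1)))))))) s1
       ((2 + n * 6) + ((1 + J * (37 * ?S)) + ((2 + n * 5) + (2 + Suc (Suc 1))))) ?Q"
    proof (rule halts_Seq[OF loop1])
      fix s2 assume s2: "?I n s2"
      then have F2: "?F s1 s2" by (auto intro: frame_mono)
      have rdy2: "ready n N0 N1 a0 a1 s2" using ready_frame[OF rdy1 F2] by auto
      have regs2: "rreg s2 17 = 2 / g" "rreg s2 9 = ?\<rho>" "rreg s2 10 = 1" "rreg s2 11 = R"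
        "rreg s2 12 = 0"
        using s1 s2 regs by (auto simp: frame_def)
      show "halts (Seq cheb_loop (Seq (sum_squares 6 14) (Seq (block [RMul 12 12 12, RMul 12 12 13])
       (Cond (RLess 12 14) (Do (RConst 8 1)) (Cond (RLess 0 3) (Do (RAdd 0 0 0)) (Do (RConst 8 1))))))) s2
       ((1 + J * (37 * ?S)) + ((2 + n * 5) + (2 + Suc (Suc 1)))) ?Q"
      proof (rule halts_Seq, rule halts_cheb_loop[OF rdy2 n regs2(1) g regs2(2-5) _ _ J(1,2)])
        show "rarr s2 6 i = 0" if "i < n" for i using s2 that by blast
        show "rarr s2 5 i = v i" if "i < n" for i using s2 v1 that by simp
        fix s3 assume s3: "frame {3, 4, 5} {10, 12, 15, 16} {5, 6} s2 s3 \<and> rreg s3 12 = 2 * real J \<and>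
          (\<forall>i<n. rarr s3 6 i = ?u (2 * J) i)"
        then have F3: "?F s2 s3" by (auto intro: frame_mono)
        have rdy3: "ready n N0 N1 a0 a1 s3" using ready_frame[OF rdy2 F3] by auto
        show "halts (Seq (sum_squares 6 14) (Seq (block [RMul 12 12 12, RMul 12 12 13])
          (Cond (RLess 12 14) (Do (RConst 8 1)) (Cond (RLess 0 3) (Do (RAdd 0 0 0)) (Do (RConst 8 1)))))) s3
          ((2 + n * 5) + (2 + Suc (Suc 1))) ?Q"
        proof (rule halts_Seq, rule halts_sum_squares)
          show "wreg s3 0 = n" "wreg s3 6 = 1" using rdy3 by (auto simp: ready_def)
          show "rreg s3 14 = 0" using s1 s2 s3 by (auto simp: frame_def)
          fix s4 assume s4: "frame {3} {14, 15} {} s3 s4 \<and> rreg s4 14 = ip n (rarr s3 6) (rarr s3 6)"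
          then have F4: "?F s3 s4" by (auto intro: frame_mono)
          have F: "?F s s4" using s1 F2 F3 F4 by (blast intro: frame_trans)
          have "rreg s4 14 = ip n (?u (2 * J)) (?u (2 * J))"
            using s3 s4 by (auto intro: ip_cong)
          moreover have "rreg s4 12 = 2 * real J" "rreg s4 13 = ip n v v" "rreg s4 0 = g"
              "rreg s4 3 = \<zeta>" "rreg s4 8 = 0"
            using s1 s2 s3 s4 regs by (auto simp: frame_def)
          ultimately have blk: "halts (block [RMul 12 12 12, RMul 12 12 13]) s4 2 (\<lambda>s5. ?F s s5 \<and>
              rreg s5 12 = (2 * real J)\<^sup>2 * ip n v v \<and> rreg s5 14 = ip n (?u (2 * J)) (?u (2 *
                J)) \<and>
              rreg s5 0 = g \<and> rreg s5 3 = \<zeta> \<and> rreg s5 8 = 0)"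
            using F by (intro halts_block) (auto simp: frame_def power2_eq_square)
          show "halts (Seq (block [RMul 12 12 12, RMul 12 12 13]) (Cond (RLess 12 14)
             (Do (RConst 8 1)) (Cond (RLess 0 3) (Do (RAdd 0 0 0)) (Do (RConst 8 1))))) s4 (2 + Suc (Suc 1)) ?Q"
          proof (rule halts_Seq[OF blk], intro halts_Cond halts_Do)
          qed (auto simp: frame_def certificate_def)
        qed auto
      qed
    qed
  qed
  then show ?thesis
  proof (rule halts_weaken)
    \<comment> \<open>The overhead besides the Chebyshev loop is 17 + 11 n, which is at most 28 J n;
      and 65 = 37 + 28.\<close>
    have "n \<le> J * n" "1 \<le> J * n" using J(3) n by simp_all
    moreover have "65 * J * ?S = J * (37 * ?S) + 28 * (J * n) + 28 * (J * N0) + 28 * (J * N1)"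
      by (simp add: algebra_simps)
    ultimately show "7 + ((2 + n * 6) + ((1 + J * (37 * ?S)) + ((2 + n * 5) + (2 + Suc (Suc 1))))) \<le>
      65 * J * ?S"
      by linarith
  qed auto
qed

text \<open>The random vector and its squared norm are prepared once, before the loop.
  \<open>zeta_test\<close> leaves array 4 intact, so every test starts from the same vector.\<close>

definition approx_zeta :: prog where
  "approx_zeta =
     Seq (block [WConst 6 1, RConst 7 1, RConst 20 2, RConst 8 0, RConst 13 0, RAdd 11 20 20, RCast 15 0,
            RMul 11 11 15, RDiv 11 11 5])
    (Seq (Cond (RLess 7 4) (block [RConst 0 0, RAdd 0 0 4]) (Do (RConst 0 1)))
    (Seq (for_loop 0 [RRand 15, RPut 4 3 15, WAdd 3 3 6])
    (Seq (sum_squares 4 13) (While (RLess 8 7) zeta_test))))"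

definition start_gamma :: "real \<Rightarrow> real" where
  "start_gamma \<gamma> = (if 1 < \<gamma> then \<gamma> else 1)"

text \<open>For a fixed tape the search is deterministic, and the tape enters the budget only
  through the stopping round \<open>K\<close>.\<close>

lemma halts_approx_zeta:
  assumes n: "n > 0"
    and wregs: "wreg s 0 = n" "wreg s 1 = N0" "wreg s 2 = N1"
    and coo: "coo N0 (warr s 0) (warr s 1) (rarr s 0) n a0" "coo N1 (warr s 2) (warr s 3) (rarr s 1) n a1"
    and regs: "rreg s 2 = \<xi>" "rreg s 3 = \<zeta>" "rreg s 4 = \<gamma>" "rreg s 5 = p"
    and g: "\<And>k. g k = start_gamma \<gamma> * 2 ^ k"
    and J: "\<And>k j. j < J k \<Longrightarrow> (1 + sqrt (\<xi> / g k)) ^ j < 4 * real n / p"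
      "\<And>k. 4 * real n / p \<le> (1 + sqrt (\<xi> / g k)) ^ J k" "\<And>k. J k > 0"
    and K: "\<And>k. k < K \<Longrightarrow> \<not> (certificate n (comb a0 a1 (g k)) (g k) (J k) (rtape
      s) \<or> \<zeta> \<le> g k)"
      "certificate n (comb a0 a1 (g K)) (g K) (J K) (rtape s) \<or> \<zeta> \<le> g K"
  shows "halts approx_zeta s (27 * n + (\<Sum>k\<le>K. 66 * J k * (n + N0 + N1))) (\<lambda>s'. result s'
    = g K)"
proof -
  let ?S = "n + N0 + N1"
  let ?R = "4 * real n / p"
  let ?A = "\<lambda>s'. ready n N0 N1 a0 a1 s' \<and> rreg s' 2 = \<xi> \<and> rreg s' 3 = \<zeta>
    \<and> rreg s' 7 = 1 \<and> rreg s' 8 = 0 \<and>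
    rreg s' 11 = ?R \<and> rreg s' 13 = 0"
  let ?B = "\<lambda>s'. ready n N0 N1 a0 a1 s' \<and> rreg s' 2 = \<xi> \<and> rreg s' 3 = \<zeta>
    \<and> rreg s' 7 = 1 \<and> rreg s' 8 = 0 \<and>
    rreg s' 11 = ?R \<and> rreg s' 0 = g 0"
  have gpos: "g k > 0" for k by (simp add: g start_gamma_def)
  have "halts approx_zeta s (9 + (Suc 2 + ((2 + n * 4) + ((2 + n * 5) + Suc (\<Sum>k<Suc K. Suc (65 * J k
    * ?S))))))
    (\<lambda>s'. result s' = g K)"
    unfolding approx_zeta_def
  proof (rule halts_Seq[where Q = "\<lambda>s'. ?A s' \<and> rreg s' 4 = \<gamma> \<and> rtape s' = rtape s"])
    show "halts (block [WConst 6 1, RConst 7 1, RConst 20 2, RConst 8 0, RConst 13 0, RAdd 11 20 20, RCast 15 0,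
            RMul 11 11 15, RDiv 11 11 5]) s 9 (\<lambda>s'. ?A s' \<and> rreg s' 4 = \<gamma> \<and>
              rtape s' = rtape s)"
      using wregs coo regs by (intro halts_block) (auto simp: ready_def)
  next
    fix s1 assume s1: "?A s1 \<and> rreg s1 4 = \<gamma> \<and> rtape s1 = rtape s"
    have *: "halts (Cond (RLess 7 4) (block [RConst 0 0, RAdd 0 0 4]) (Do (RConst 0 1))) s1 (Suc 2)
      (\<lambda>s'. ?B s' \<and> rreg s' 13 = 0 \<and> rtape s' = rtape s)"
      using s1 by (intro halts_Cond halts_block halts_Do) (auto simp: ready_def g start_gamma_def)
    show "halts (Seq (Cond (RLess 7 4) (block [RConst 0 0, RAdd 0 0 4]) (Do (RConst 0 1)))
        (Seq (for_loop 0 [RRand 15, RPut 4 3 15, WAdd 3 3 6])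
        (Seq (sum_squares 4 13) (While (RLess 8 7) zeta_test)))) s1
        (Suc 2 + ((2 + n * 4) + ((2 + n * 5) + Suc (\<Sum>k<Suc K. Suc (65 * J k * ?S))))) (\<lambda>s'.
          result s' = g K)"
    proof (rule halts_Seq[OF *])
      fix s2 assume s2: "?B s2 \<and> rreg s2 13 = 0 \<and> rtape s2 = rtape s"
      let ?I = "\<lambda>k s'. wreg s' 3 = k \<and> frame {3} {15} {4} s2 s' \<and> (\<forall>i<k. rarr
        s' 4 i = rtape s i) \<and>
        (\<forall>i. rtape s' i = rtape s (k + i))"
      have "halts (for_loop 0 [RRand 15, RPut 4 3 15, WAdd 3 3 6]) s2
        (2 + n * Suc (length [RRand 15, RPut 4 3 15, WAdd 3 3 6])) (?I n)"
        by (rule halts_for_loop) (use s2 in \<open>auto simp: frame_def ready_def less_Suc_eq\<close>)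
      then have loop: "halts (for_loop 0 [RRand 15, RPut 4 3 15, WAdd 3 3 6]) s2 (2 + n * 4) (?I n)"
        by (rule halts_weaken) auto
      show "halts (Seq (for_loop 0 [RRand 15, RPut 4 3 15, WAdd 3 3 6])
        (Seq (sum_squares 4 13) (While (RLess 8 7) zeta_test))) s2
        ((2 + n * 4) + ((2 + n * 5) + Suc (\<Sum>k<Suc K. Suc (65 * J k * ?S)))) (\<lambda>s'. result s' = g K)"
      proof (rule halts_Seq[OF loop])
        fix s3 assume s3: "?I n s3"
        then have rdy3: "ready n N0 N1 a0 a1 s3" using ready_frame[of n N0 N1 a0 a1 s2 _ _ _ s3] s2 by auto
        show "halts (Seq (sum_squares 4 13) (While (RLess 8 7) zeta_test)) s3
          ((2 + n * 5) + Suc (\<Sum>k<Suc K. Suc (65 * J k * ?S))) (\<lambda>s'. result s' = g K)"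
        proof (rule halts_Seq, rule halts_sum_squares)
          show "wreg s3 0 = n" "wreg s3 6 = 1" using rdy3 by (auto simp: ready_def)
          show "rreg s3 13 = 0" using s2 s3 by (auto simp: frame_def)
          fix s4 assume s4: "frame {3} {13, 15} {} s3 s4 \<and> rreg s4 13 = ip n (rarr s3 4) (rarr s3 4)"
          have rdy4: "ready n N0 N1 a0 a1 s4" using ready_frame[OF rdy3] s4 by auto
          have regs4: "rreg s4 13 = ip n (rtape s) (rtape s)" "rreg s4 2 = \<xi>" "rreg s4 3 = \<zeta>"
            "rreg s4 7 = 1"
              "rreg s4 8 = 0" "rreg s4 11 = ?R" "rreg s4 0 = g 0"
            using s2 s3 s4 by (auto simp: frame_def intro: ip_cong)
          have v4: "rarr s4 4 i = rtape s i" if "i < n" for i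
            using s3 s4 that by (auto simp: frame_def)
          let ?F = "frame {3, 4, 5} {0, 8, 9, 10, 12, 14, 15, 16, 17} {5, 6}"
          \<comment> \<open>Round \<open>K\<close> raises the flag and leaves \<gamma> alone; hence
            \<open>min k K\<close>, which lets the invariant at \<open>Suc K\<close> still speak of
            \<open>g K\<close>.\<close>
          define I where "I k s' \<longleftrightarrow> ?F s4 s' \<and> rreg s' 8 = (if k \<le> K then 0
            else 1) \<and>
            rreg s' 0 = g (min k K)" for k s'
          have "halts (While (RLess 8 7) zeta_test) s4 (Suc (\<Sum>k<Suc K. Suc (65 * J k * ?S))) (I (Suc K))"
          proof (rule halts_While)
            fix k s5 assume k: "k < Suc K" and I: "I k s5"
            have F5: "?F s4 s5" using I by (simp add: I_def)
            have rdy5: "ready n N0 N1 a0 a1 s5" using ready_frame[OF rdy4 F5] by auto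
            have regs5: "rreg s5 0 = g k" "rreg s5 2 = \<xi>" "rreg s5 3 = \<zeta>" "rreg s5 7 = 1" "rreg
              s5 8 = 0"
               "rreg s5 11 = ?R" "rreg s5 13 = ip n (rtape s) (rtape s)"
              using I k regs4 by (auto simp: I_def frame_def)
            have v5: "rarr s5 4 i = rtape s i" if "i < n" for i
              using F5 v4 that by (auto simp: frame_def)
            have "halts zeta_test s5 (65 * J k * ?S) (I (Suc k))"
            proof (rule halts_weaken[OF halts_zeta_test[OF rdy5 n gpos regs5 v5 J(1) J(2) J(3)]])
              fix s6 assume s6: "?F s5 s6 \<and> (if certificate n (comb a0 a1 (g k)) (g k) (J k) (rtape
                s) \<or> \<zeta> \<le> g k
                then rreg s6 8 = 1 \<and> rreg s6 0 = g k else rreg s6 8 = 0 \<and> rreg s6 0 = g k + g k)"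
              have "?F s4 s6" using F5 s6 by (blast intro: frame_trans)
              moreover have "rreg s6 8 = (if Suc k \<le> K then 0 else 1) \<and> rreg s6 0 = g (min (Suc k) K)"
              proof (cases "k = K")
                case True
                then show ?thesis using s6 K(2) by simp
              next
                case False
                then have "k < K" using k by simp
                then show ?thesis using s6 K(1)[of k] by (simp add: g min_def)
              qed
              ultimately show "I (Suc k) s6" by (simp add: I_def)
            qed auto
            then show "eval_test (RLess 8 7) s5 \<and> halts zeta_test s5 (65 * J k * ?S) (I (Suc k))"
              using regs5 by simp
          next
            fix s5 assume "I (Suc K) s5"
            then show "\<not> eval_test (RLess 8 7) s5" using regs4 by (simp add: I_def frame_def)
          next
            show "I 0 s4" using regs4 by (simp add: I_def frame_refl)
          qed
          then show "halts (While (RLess 8 7) zeta_test) s4 (Suc (\<Sum>k<Suc K. Suc (65 * J k * ?S)))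
            (\<lambda>s'. result s' = g K)"
            by (rule halts_weaken) (auto simp: I_def result_def)
        qed auto
      qed
    qed
  qed
  then show ?thesis
  proof (rule halts_weaken)
    \<comment> \<open>The loop test costs one more unit per round, absorbed by the positive product
      \<open>J k * n\<close>; this turns 65 into 66.\<close>
    have "Suc (65 * J k * ?S) \<le> 66 * J k * ?S" for k
    proof -
      have "1 \<le> J k * n" using J(3)[of k] n by simp
      moreover have "66 * J k * ?S = 65 * J k * ?S + J k * n + J k * N0 + J k * N1" by (simp add: algebra_simps)
      ultimately show ?thesis by linarith
    qed
    then have "(\<Sum>k<Suc K. Suc (65 * J k * ?S)) \<le> (\<Sum>k<Suc K. 66 * J k * ?S)" by (rule sum_mono)
    then show "9 + (Suc 2 + ((2 + n * 4) + ((2 + n * 5) + Suc (\<Sum>k<Suc K. Suc (65 * J k * ?S)))))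
      \<le> 27 * n + (\<Sum>k\<le>K. 66 * J k * ?S)"
      using n unfolding lessThan_Suc_atMost by linarith
  qed
qed

section \<open>Random start vectors\<close>

abbreviation unif :: "real measure" where
  "unif \<equiv> uniform_measure lborel {0..1}"

lemma prob_space_unif: "prob_space unif"
  by (rule prob_space_uniform_measure) auto

lemma prob_space_tape: "prob_space tape_measure"
  unfolding tape_measure_def by (rule prob_space_PiM) (rule prob_space_unif)

lemma measurable_tape_component [measurable]: "(\<lambda>\<omega>. \<omega> i) \<in> borel_measurable
  tape_measure"
proof -
  have "(\<lambda>\<omega>. \<omega> i) \<in> measurable tape_measure unif"
    unfolding tape_measure_def by (rule measurable_component_singleton) simp
  then show ?thesis by (simp cong: measurable_cong_sets)
qed

lemma AE_tape_bounded: "AE \<omega> in tape_measure. \<forall>i<n. 0 \<le> \<omega> i \<and> \<omega> i \<le> 1"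
proof -
  have "AE x in unif. 0 \<le> x \<and> x \<le> 1"
    by (rule AE_uniform_measureI) auto
  then have "AE \<omega> in tape_measure. 0 \<le> \<omega> i \<and> \<omega> i \<le> 1" for i
    unfolding tape_measure_def
    by (rule AE_PiM_component[rotated 2]) (auto intro: prob_space_unif)
  then have "AE \<omega> in tape_measure. \<forall>i. 0 \<le> \<omega> i \<and> \<omega> i \<le> 1" by
    (simp add: AE_all_countable)
  then show ?thesis by eventually_elim auto
qed

lemma emeasure_unif_slab:
  assumes "b \<noteq> 0" "e \<ge> 0"
  shows "emeasure unif {x. \<bar>b * x + c\<bar> \<le> e} \<le> ennreal (2 * e / \<bar>b\<bar>)"
proof -
  have sub: "{x. \<bar>b * x + c\<bar> \<le> e} \<subseteq> cball (- c / b) (e / \<bar>b\<bar>)"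
  proof
    fix x assume "x \<in> {x. \<bar>b * x + c\<bar> \<le> e}"
    moreover have "b * x + c = b * (x + c / b)" using assms by (simp add: distrib_left)
    ultimately have "\<bar>b\<bar> * \<bar>x + c / b\<bar> \<le> e" by (simp only: mem_Collect_eq abs_mult)
    then have "\<bar>x + c / b\<bar> \<le> e / \<bar>b\<bar>" using assms by (simp add: pos_le_divide_eq
      mult.commute)
    then show "x \<in> cball (- c / b) (e / \<bar>b\<bar>)" by (simp add: dist_real_def abs_minus_commute
      add.commute)
  qed
  have "emeasure unif {x. \<bar>b * x + c\<bar> \<le> e} = emeasure lborel ({0..1} \<inter> {x. \<bar>b *
    x + c\<bar> \<le> e})"
    by (subst emeasure_uniform_measure) (auto simp: divide_ennreal_def)
  also have "\<dots> \<le> emeasure lborel (cball (- c / b) (e / \<bar>b\<bar>))"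
    by (rule emeasure_mono) (use sub in auto)
  also have "\<dots> = ennreal (2 * e / \<bar>b\<bar>)"
    using assms by (simp add: cball_eq_atLeastAtMost)
  finally show ?thesis .
qed

text \<open>Anti-concentration from a single coordinate: a unit vector has an entry of modulus at
  least 1 / sqrt n, and once all other tape cells are fixed, that cell must hit an interval of
  length at most 2 e sqrt n.\<close>

lemma prob_slab:
  assumes u: "ip n u u = 1" and e: "e \<ge> 0"
  shows "measure tape_measure {\<omega> \<in> space tape_measure. \<bar>ip n u \<omega>\<bar> \<le> e}
    \<le> 2 * e * sqrt (real n)"
proof -
  have n: "n > 0" using u by (cases n) (auto simp: ip_def)
  obtain j where j: "j < n" "1 / real n \<le> u j * u j"
  proof (rule ccontr)
    assume "\<not> thesis"
    then have "\<And>j. j < n \<Longrightarrow> u j * u j < 1 / real n" using that by force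
    then have "ip n u u < (\<Sum>i<n. 1 / real n)"
      unfolding ip_def using n by (intro sum_strict_mono) auto
    then show False using u n by simp
  qed
  have uj: "1 / sqrt (real n) \<le> \<bar>u j\<bar>"
    using real_sqrt_le_mono[OF j(2)] by (simp add: real_sqrt_divide flip: power2_eq_square)
  then have uj0: "u j \<noteq> 0" using n by auto
  define P where "P = (\<Pi>\<^sub>M i\<in>UNIV - {j}. unif)"
  interpret P: prob_space P unfolding P_def by (rule prob_space_PiM) (rule prob_space_unif)
  interpret U: prob_space unif by (rule prob_space_unif)
  interpret T: prob_space tape_measure by (rule prob_space_tape)
  interpret pair_sigma_finite unif P ..
  let ?B = "{\<omega> \<in> space tape_measure. \<bar>ip n u \<omega>\<bar> \<le> e}"
  let ?f = "\<lambda>(x, X). X(j := x)"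
  have B: "?B \<in> sets tape_measure" unfolding ip_def by measurable
  have ins: "insert j (UNIV - {j}) = UNIV" by auto
  \<comment> \<open>Preparation for Fubini: the tape is an independent cell \<open>j\<close>
    inserted into the sequence of all others.\<close>
  have tape: "distr (unif \<Otimes>\<^sub>M P) tape_measure ?f = tape_measure"
    using distr_pair_PiM_eq_PiM[of "UNIV - {j}" "\<lambda>_. unif" j]
    unfolding ins P_def tape_measure_def by (simp add: prob_space_unif)
  have f: "?f \<in> measurable (unif \<Otimes>\<^sub>M P) tape_measure"
  proof -
    have "?f \<in> measurable (unif \<Otimes>\<^sub>M P) (\<Pi>\<^sub>M i\<in>insert j (UNIV - {j}). unif)"
      unfolding P_def by measurable
    then show ?thesis unfolding ins tape_measure_def .
  qed
  have "emeasure tape_measure ?B = emeasure (distr (unif \<Otimes>\<^sub>M P) tape_measure ?f) ?B"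
    by (simp add: tape)
  also have "\<dots> = emeasure (unif \<Otimes>\<^sub>M P) (?f -` ?B \<inter> space (unif \<Otimes>\<^sub>M P))"
    by (rule emeasure_distr[OF f B])
  also have "\<dots> = (\<integral>\<^sup>+X. emeasure unif ((\<lambda>x. (x, X)) -` (?f -` ?B \<inter>
    space (unif \<Otimes>\<^sub>M P))) \<partial>P)"
    by (rule emeasure_pair_measure_alt2) (rule measurable_sets[OF f B])
  also have "\<dots> \<le> (\<integral>\<^sup>+X. ennreal (2 * e * sqrt (real n)) \<partial>P)"
  proof (rule nn_integral_mono)
    fix X assume "X \<in> space P"
    define c where "c = (\<Sum>i\<in>{..<n} - {j}. u i * X i)"
    have "ip n u (X(j := x)) = u j * x + c" for x
      unfolding ip_def c_def by (subst sum.remove[of _ j]) (use j in auto)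
    then have "(\<lambda>x. (x, X)) -` (?f -` ?B \<inter> space (unif \<Otimes>\<^sub>M P)) \<subseteq>
      {x. \<bar>u j * x + c\<bar> \<le> e}"
      by auto
    then have "emeasure unif ((\<lambda>x. (x, X)) -` (?f -` ?B \<inter> space (unif \<Otimes>\<^sub>M P)))
      \<le> emeasure unif {x. \<bar>u j * x + c\<bar> \<le> e}"
      by (rule emeasure_mono) simp
    also have "\<dots> \<le> ennreal (2 * e / \<bar>u j\<bar>)" by (rule emeasure_unif_slab[OF uj0 e])
    also have "\<dots> \<le> ennreal (2 * e * sqrt (real n))"
    proof (rule ennreal_leI)
      have "1 / \<bar>u j\<bar> \<le> sqrt (real n)" using uj uj0 n by (simp add: field_simps)
      then show "2 * e / \<bar>u j\<bar> \<le> 2 * e * sqrt (real n)"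
        using e mult_left_mono[of "1 / \<bar>u j\<bar>" "sqrt (real n)" "2 * e"] by simp
    qed
    finally show "emeasure unif ((\<lambda>x. (x, X)) -` (?f -` ?B \<inter> space (unif \<Otimes>\<^sub>M P)))
      \<le> ennreal (2 * e * sqrt (real n))" .
  qed
  also have "\<dots> = ennreal (2 * e * sqrt (real n))" by (simp add: P.emeasure_space_1)
  finally show ?thesis using e by (simp add: T.emeasure_eq_measure)
qed

lemma measurable_cheb [measurable]: "(\<lambda>\<omega>. cheb n a g \<omega> k i) \<in> borel_measurable
  tape_measure"
proof (induction k arbitrary: i rule: induct_nat_012)
  case (ge2 k)
  note [measurable] = ge2
  show ?case unfolding cheb.simps mv_def by measurable
qed simp_all

section \<open>Matrix pencils\<close>

definition entry :: "real mat \<Rightarrow> nat \<Rightarrow> nat \<Rightarrow> real" where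
  "entry A i j = A $$ (i, j)"

lemma mult_mat_vec_entry:
  assumes "A \<in> carrier_mat n n"
  shows "A *\<^sub>v Matrix.vec n x = Matrix.vec n (mv n (entry A) x)"
  using assms by (intro eq_vecI) (auto simp: scalar_prod_def mv_def entry_def atLeast0LessThan)

lemma scalar_prod_vec: "scalar_prod (Matrix.vec n x) (Matrix.vec n y) = ip n x y"
  by (simp add: scalar_prod_def ip_def atLeast0LessThan)

lemma vnorm_vec: "vnorm (Matrix.vec n x) = sqrt (ip n x x)"
  by (simp add: vnorm_def scalar_prod_vec)

lemma carrier_vec_eq_range: "carrier_vec n = range (Matrix.vec n)"
proof -
  have "v = Matrix.vec n (\<lambda>i. v $ i)" if "v \<in> carrier_vec n" for v :: "'a Matrix.vec"
    using that by (intro eq_vecI) auto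
  then show ?thesis by (auto simp: image_iff)
qed

lemma eigenvalue_entry:
  assumes A: "A \<in> carrier_mat n n"
  shows "eigenvalue A k \<longleftrightarrow> (\<exists>x. ip n x x > 0 \<and> (\<forall>i<n. mv n (entry
    A) x i = k * x i))"
proof -
  have nz: "Matrix.vec n x \<noteq> 0\<^sub>v n \<longleftrightarrow> ip n x x > 0" for x
  proof -
    have "Matrix.vec n x = 0\<^sub>v n \<longleftrightarrow> (\<forall>i<n. x i = 0)" by (auto simp: vec_eq_iff)
    also have "\<dots> \<longleftrightarrow> ip n x x = 0" by (simp add: ip_def sum_nonneg_eq_0_iff
      lessThan_def)
    finally show ?thesis using ip_self_nonneg[of n x] by linarith
  qed
  have "eigenvalue A k \<longleftrightarrow> (\<exists>v\<in>carrier_vec n. v \<noteq> 0\<^sub>v n \<and>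
    A *\<^sub>v v = k \<cdot>\<^sub>v v)"
    using A by (auto simp: eigenvalue_def eigenvector_def)
  also have "\<dots> \<longleftrightarrow> (\<exists>x. Matrix.vec n x \<noteq> 0\<^sub>v n \<and> A
    *\<^sub>v Matrix.vec n x = k \<cdot>\<^sub>v Matrix.vec n x)"
    unfolding carrier_vec_eq_range by simp
  also have "\<dots> \<longleftrightarrow> (\<exists>x. ip n x x > 0 \<and> (\<forall>i<n. mv n (entry A)
    x i = k * x i))"
    unfolding nz mult_mat_vec_entry[OF A] by (auto simp: vec_eq_iff)
  finally show ?thesis .
qed

text \<open>A supremum of reals dominates its members only if the set is bounded above; the squared
  Frobenius norm \<open>C\<close> first supplies a crude bound. Homogeneity then passes from unit
  vectors to all vectors.\<close>

lemma spectral_norm_bound: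
  assumes A: "A \<in> carrier_mat n n" and le: "spectral_norm A \<le> 1"
  shows "ip n (mv n (entry A) x) (mv n (entry A) x) \<le> ip n x x"
proof -
  let ?a = "entry A"
  let ?S = "{vnorm (A *\<^sub>v v) | v. v \<in> carrier_vec (dim_col A) \<and> vnorm v = 1}"
  define C where "C = (\<Sum>i<n. ip n (?a i) (?a i))"
  have row: "mv n ?a y i = ip n (?a i) y" for y i by (simp add: mv_def ip_def)
  have crude: "ip n (mv n ?a y) (mv n ?a y) \<le> C * ip n y y" for y
  proof -
    have "ip n (mv n ?a y) (mv n ?a y) = (\<Sum>i<n. (ip n (?a i) y)\<^sup>2)"
      by (simp add: ip_def[of n "mv n ?a y"] row power2_eq_square)
    also have "\<dots> \<le> (\<Sum>i<n. ip n (?a i) (?a i) * ip n y y)"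
    proof (rule sum_mono)
      fix i
      have "\<bar>ip n (?a i) y\<bar>\<^sup>2 \<le> (sqrt (ip n (?a i) (?a i)) * sqrt (ip n y y))\<^sup>2"
        by (rule power_mono[OF ip_Cauchy_Schwarz]) simp
      then show "(ip n (?a i) y)\<^sup>2 \<le> ip n (?a i) (?a i) * ip n y y"
        by (simp add: power_mult_distrib ip_self_nonneg)
    qed
    finally show ?thesis by (simp add: C_def sum_distrib_right)
  qed
  have unit: "ip n (mv n ?a y) (mv n ?a y) \<le> 1" if y: "ip n y y = 1" for y
  proof -
    have "bdd_above ?S"
    proof (rule bdd_aboveI)
      fix r assume "r \<in> ?S"
      then obtain v where v: "r = vnorm (A *\<^sub>v v)" "v \<in> carrier_vec n" "vnorm v = 1"
        using A by auto
      then obtain z where "v = Matrix.vec n z" unfolding carrier_vec_eq_range by blast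
      with v have "r = vnorm (A *\<^sub>v Matrix.vec n z)" "vnorm (Matrix.vec n z) = 1" by simp_all
      then have "r = sqrt (ip n (mv n ?a z) (mv n ?a z))" "ip n z z = 1"
        by (simp_all add: mult_mat_vec_entry[OF A] vnorm_vec)
      then show "r \<le> sqrt C" using crude[of z] by simp
    qed
    moreover have "vnorm (A *\<^sub>v Matrix.vec n y) \<in> ?S"
      using A y by (auto simp: vnorm_vec intro!: exI[of _ "Matrix.vec n y"])
    ultimately have "vnorm (A *\<^sub>v Matrix.vec n y) \<le> spectral_norm A"
      unfolding spectral_norm_def by (intro cSup_upper)
    then have "sqrt (ip n (mv n ?a y) (mv n ?a y)) \<le> 1"
      using le unfolding mult_mat_vec_entry[OF A] vnorm_vec by (rule order.trans)
    then show ?thesis by simp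
  qed
  show ?thesis
  proof (cases "ip n x x = 0")
    case True
    then show ?thesis using crude[of x] by simp
  next
    case False
    then have pos: "ip n x x > 0" using ip_self_nonneg[of n x] by simp
    define c where "c = inverse (sqrt (ip n x x))"
    have c: "c * c * ip n x x = 1" using pos by (simp add: c_def field_simps)
    have "ip n (mv n ?a (\<lambda>i. c * x i)) (mv n ?a (\<lambda>i. c * x i)) \<le> 1"
      by (rule unit) (use c in \<open>simp add: mult.assoc\<close>)
    then have "c * c * ip n (mv n ?a x) (mv n ?a x) \<le> c * c * ip n x x" using c by (simp add: mult.assoc)
    moreover have "c * c > 0" using pos by (simp add: c_def)
    ultimately show ?thesis by (simp only: mult_le_cancel_left_pos)
  qed
qed

text \<open>Positions outside the list carry zero entries, so the sum over the list extends to the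
  full square and splits into rows. Distinctness prevents double counting.\<close>

lemma coo_coordinate_list:
  assumes A: "A \<in> carrier_mat n n" and es: "coordinate_list A es"
  shows "coo (length es) (cells (map fst es)) (cells (map snd es)) (cells (map (\<lambda>e. A $$ e) es))
    n (entry A)"
  unfolding coo_def
proof (intro allI impI)
  fix x i assume i: "i < n"
  define f where "f e = (if fst e = i then A $$ e * x (snd e) else 0)" for e
  have sub: "nonzeros A \<subseteq> {..<n} \<times> {..<n}" using A by (auto simp: nonzeros_def)
  have "coo_mv (length es) (cells (map fst es)) (cells (map snd es)) (cells (map (\<lambda>e. A $$ e) es)) x i
    = (\<Sum>l<length es. f (es ! l))"
    unfolding coo_mv_def f_def by (intro sum.cong) (auto simp: cells_def)
  also have "\<dots> = sum_list (map f es)" by (simp add: sum_list_sum_nth atLeast0LessThan)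
  also have "\<dots> = (\<Sum>e\<in>nonzeros A. f e)"
    using es by (simp add: coordinate_list_def sum_list_distinct_conv_sum_set)
  also have "\<dots> = (\<Sum>e\<in>{..<n} \<times> {..<n}. f e)"
    by (rule sum.mono_neutral_left[OF _ sub]) (use A in \<open>auto simp: f_def nonzeros_def\<close>)
  also have "\<dots> = (\<Sum>k<n. \<Sum>j<n. f (k, j))" by (simp add: sum.cartesian_product)
  also have "\<dots> = (\<Sum>k<n. if k = i then mv n (entry A) x i else 0)"
    by (intro sum.cong) (auto simp: f_def mv_def entry_def)
  also have "\<dots> = mv n (entry A) x i" using i by simp
  finally show "coo_mv (length es) (cells (map fst es)) (cells (map snd es)) (cells (map (\<lambda>e. A
    $$ e) es)) x i
    = mv n (entry A) x i" .
qed

text \<open>The Rayleigh minimum is itself an eigenvalue, hence at least \<open>lambda_min\<close>;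
  for \<open>Min\<close> to be a lower bound, the spectrum must be finite, which follows from the
  characteristic polynomial.\<close>

lemma lambda_min_le_form:
  assumes A: "A \<in> carrier_mat n n" and a: "sym_upto n (entry A)" and n: "n > 0" and le: "\<xi> \<le>
    lambda_min A"
  shows "\<xi> * ip n x x \<le> ip n x (mv n (entry A) x)"
proof -
  from rayleigh_min[OF n a] obtain u m where u: "ip n u u = 1" "\<forall>i<n. mv n (entry A) u i = m * u i"
    and m: "\<And>y. m * ip n y y \<le> ip n y (mv n (entry A) y)" by blast
  then have "eigenvalue A m" unfolding eigenvalue_entry[OF A] by (intro exI[of _ u]) simp
  moreover have "finite {k. eigenvalue A k}"
    unfolding eigenvalue_root_char_poly[OF A]
    by (rule poly_roots_finite) (use degree_monic_char_poly[OF A] in auto)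
  ultimately have "\<xi> \<le> m" using le unfolding lambda_min_def by (auto intro: order.trans Min_le)
  then have "\<xi> * ip n x x \<le> m * ip n x x" by (rule mult_right_mono) (rule ip_self_nonneg)
  with m[of x] show ?thesis by linarith
qed

lemma finite_nonzeros: "finite (nonzeros A)"
  by (rule finite_subset[of _ "{..<dim_row A} \<times> {..<dim_col A}"]) (auto simp: nonzeros_def)

section \<open>Semidefiniteness along the pencil\<close>

locale quadratic_pair =
  fixes n :: nat and q0 q1 :: quadratic
  assumes A: "assumption_A n q0 q1"
begin

abbreviation a0 where "a0 \<equiv> entry (qmat q0)"
abbreviation a1 where "a1 \<equiv> entry (qmat q1)"
abbreviation a where "a \<gamma> \<equiv> comb a0 a1 \<gamma>"

lemma carrier: "qmat q0 \<in> carrier_mat n n" "qmat q1 \<in> carrier_mat n n"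
    "pencil q0 q1 \<gamma> \<in> carrier_mat n n"
  using A by (auto simp: assumption_A_def pencil_def)

lemma n_pos: "n > 0"
  using A eigenvalue_imp_nonzero_dim[OF carrier(1)] by (auto simp: assumption_A_def)

lemma sym_entry: "M \<in> carrier_mat n n \<Longrightarrow> transpose_mat M = M \<Longrightarrow>
  sym_upto n (entry M)"
proof (unfold sym_upto_def entry_def, intro allI impI)
  fix i j assume M: "M \<in> carrier_mat n n" "transpose_mat M = M" and ij: "i < n" "j < n"
  have "M $$ (i, j) = transpose_mat M $$ (i, j)" by (simp only: M(2))
  also have "\<dots> = M $$ (j, i)" using M(1) ij by simp
  finally show "M $$ (i, j) = M $$ (j, i)" .
qed

lemma sym: "sym_upto n a0" "sym_upto n a1" "sym_upto n (a \<gamma>)"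
proof -
  show *: "sym_upto n a0" "sym_upto n a1"
    using A by (auto simp: assumption_A_def intro: sym_entry)
  then show "sym_upto n (a \<gamma>)" by (simp add: sym_upto_def comb_def)
qed

lemma entry_pencil: "i < n \<Longrightarrow> j < n \<Longrightarrow> entry (pencil q0 q1 \<gamma>) i j =
  a \<gamma> i j"
  using carrier by (simp add: entry_def pencil_def comb_def)

lemma mv_pencil: "i < n \<Longrightarrow> mv n (entry (pencil q0 q1 \<gamma>)) x i = mv n (a \<gamma>) x i"
  by (simp add: mv_def entry_pencil)

lemma form_pencil: "ip n x (mv n (entry (pencil q0 q1 \<gamma>)) x) = ip n x (mv n (a \<gamma>) x)"
  by (rule ip_cong) (simp_all add: mv_pencil)

lemma form_comb: "ip n x (mv n (a \<gamma>) x) = ip n x (mv n a0 x) + \<gamma> * ip n x (mv n a1 x)"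
proof -
  have "mv n (a \<gamma>) x = (\<lambda>i. mv n a0 x i + \<gamma> * mv n a1 x i)" by (simp add:
    fun_eq_iff mv_comb)
  then show ?thesis by simp
qed

lemma pos_semidef_iff: "pos_semidef (pencil q0 q1 \<gamma>) \<longleftrightarrow> (\<forall>x. 0 \<le> ip
  n x (mv n (a \<gamma>) x))"
proof -
  have "dim_row (pencil q0 q1 \<gamma>) = n" using carrier(3)[of \<gamma>] by auto
  then show ?thesis
    unfolding pos_semidef_def
    by (simp add: carrier_vec_eq_range mult_mat_vec_entry[OF carrier(3)] scalar_prod_vec form_pencil)
qed

text \<open>The norm of A(\<gamma>) is at most 1 + \<gamma>, hence at most 2 \<gamma> from 1 on.
  This is the upper bound required by \<open>cheb_bounded\<close> with g = \<gamma>, and the reason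
  for starting the search at 1 or above.\<close>

lemma form_le:
  assumes "\<gamma> \<ge> 1"
  shows "ip n x (mv n (a \<gamma>) x) \<le> 2 * \<gamma> * ip n x x"
proof -
  have *: "ip n x (mv n (entry M) x) \<le> ip n x x" if "M \<in> carrier_mat n n" "spectral_norm M \<le>
    1" for M
  proof -
    have "ip n x (mv n (entry M) x) \<le> sqrt (ip n x x) * sqrt (ip n (mv n (entry M) x) (mv n (entry M) x))"
      using ip_Cauchy_Schwarz[of n x "mv n (entry M) x"] by linarith
    also have "\<dots> \<le> sqrt (ip n x x) * sqrt (ip n x x)"
      using spectral_norm_bound[OF that] by (intro mult_left_mono) (auto simp: ip_self_nonneg)
    finally show ?thesis by (simp add: ip_self_nonneg)
  qed
  have "ip n x (mv n a0 x) \<le> ip n x x" "ip n x (mv n a1 x) \<le> ip n x x"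
    using A by (auto simp: assumption_A_def intro: *)
  then have "ip n x (mv n a0 x) + \<gamma> * ip n x (mv n a1 x) \<le> \<gamma> * ip n x x + \<gamma> * ip n x x"
    using assms mult_right_mono[of 1 \<gamma> "ip n x x"] ip_self_nonneg[of n x]
    by (intro add_mono) (auto intro: mult_left_mono)
  then show ?thesis by (simp add: form_comb)
qed

lemma negative_direction:
  assumes "M = qmat q0 \<or> M = qmat q1" shows "\<exists>x. ip n x (mv n (entry M) x) < 0"
proof -
  from assms have M: "M \<in> carrier_mat n n" using carrier by auto
  from assms A obtain k where "k < 0" "eigenvalue M k" by (auto simp: assumption_A_def)
  then obtain x where x: "ip n x x > 0" "\<forall>i<n. mv n (entry M) x i = k * x i"
    unfolding eigenvalue_entry[OF M] by blast
  then have "ip n x (mv n (entry M) x) = ip n x (\<lambda>i. k * x i)" by (intro ip_cong) auto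
  also have "\<dots> < 0" using x \<open>k < 0\<close> by (simp add: mult_neg_pos)
  finally show ?thesis by blast
qed

text \<open>Along a negative direction of \<open>a1\<close> the form of the pencil is affine and
  strictly decreasing in \<gamma>, so it is eventually negative.\<close>

lemma bdd_above_Gamma: "bdd_above (Gamma_set q0 q1)"
proof -
  obtain x where x: "ip n x (mv n a1 x) < 0" using negative_direction by blast
  have "\<gamma> \<le> ip n x (mv n a0 x) / - ip n x (mv n a1 x)" if "\<gamma> \<in> Gamma_set q0 q1" for
    \<gamma>
  proof -
    have "0 \<le> ip n x (mv n a0 x) + \<gamma> * ip n x (mv n a1 x)"
      using that by (simp add: Gamma_set_def pos_semidef_iff flip: form_comb)
    then show ?thesis using x by (simp add: neg_le_divide_eq field_simps)
  qed
  then show ?thesis by (rule bdd_aboveI)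
qed

text \<open>Affinity in \<gamma> does the work of concavity of the smallest eigenvalue.\<close>

lemma form_interpolate:
  assumes "\<gamma> = (1 - t) * \<gamma>1 + t * \<gamma>2"
  shows "ip n x (mv n (a \<gamma>) x) = (1 - t) * ip n x (mv n (a \<gamma>1) x) + t * ip n x (mv n (a
    \<gamma>2) x)"
  by (simp add: form_comb assms algebra_simps)

text \<open>A positive definite combination has a positive diagonal, so every row contains a nonzero
  entry of one of the matrices. Vector operations of cost O(n) can then be charged to N.\<close>

lemma n_le_nnz:
  assumes pos: "\<And>x. ip n x x > 0 \<Longrightarrow> ip n x (mv n (a \<gamma>) x) > 0"
  shows "n \<le> nnz q0 q1"
proof -
  have fin: "finite (nonzeros (qmat q0))" "finite (nonzeros (qmat q1))"
    by (auto intro: finite_nonzeros)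
  have "{..<n} \<subseteq> fst ` nonzeros (qmat q0) \<union> fst ` nonzeros (qmat q1)"
  proof
    fix i assume "i \<in> {..<n}"
    then have i: "i < n" by simp
    let ?e = "\<lambda>j. if j = i then 1 else 0 :: real"
    have pick: "ip n ?e y = y i" for y
      using i sum.delta[of "{..<n}" i y] by (simp add: ip_def if_distrib[of "\<lambda>c. c * _"] cong: if_cong)
    have "ip n ?e ?e = 1" by (simp add: pick)
    moreover have "mv n (a \<gamma>) ?e i = a \<gamma> i i"
      using pick[of "a \<gamma> i"] by (simp add: mv_def ip_def mult.commute)
    then have "ip n ?e (mv n (a \<gamma>) ?e) = a \<gamma> i i" by (simp add: pick)
    ultimately have "a \<gamma> i i > 0" using pos[of ?e] by simp
    then have "a0 i i \<noteq> 0 \<or> a1 i i \<noteq> 0" by (auto simp: comb_def)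
    then have "(i, i) \<in> nonzeros (qmat q0) \<or> (i, i) \<in> nonzeros (qmat q1)"
      using carrier i by (auto simp: nonzeros_def entry_def)
    then show "i \<in> fst ` nonzeros (qmat q0) \<union> fst ` nonzeros (qmat q1)" by force
  qed
  then have "card {..<n} \<le> card (fst ` nonzeros (qmat q0) \<union> fst ` nonzeros (qmat q1))"
    using fin by (intro card_mono) auto
  also have "\<dots> \<le> card (fst ` nonzeros (qmat q0)) + card (fst ` nonzeros (qmat q1))"
    by (rule card_Un_le)
  also have "\<dots> \<le> nnz q0 q1" unfolding nnz_def using fin by (intro add_mono card_image_le) auto
  finally show ?thesis by simp
qed

end

section \<open>Consequences of the given feasible multiplier\<close>

locale feasible_pair = quadratic_pair +
  fixes \<xi> \<gamma>' :: real
  assumes xi: "\<xi> > 0" and gamma': "\<gamma>' \<ge> 0" and lmin: "lambda_min (pencil q0 q1 \<gamma>')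
    \<ge> \<xi>"
begin

lemma form_gamma': "\<xi> * ip n x x \<le> ip n x (mv n (a \<gamma>') x)"
proof -
  have "sym_upto n (entry (pencil q0 q1 \<gamma>'))"
    using sym(3)[of \<gamma>'] by (simp add: sym_upto_def entry_pencil)
  from lambda_min_le_form[OF carrier(3) this n_pos lmin] show ?thesis by (simp add: form_pencil)
qed

lemma gamma'_in_Gamma: "\<gamma>' \<in> Gamma_set q0 q1"
proof -
  have "0 \<le> ip n x (mv n (a \<gamma>') x)" for x
    using form_gamma'[of x] ip_self_nonneg[of n x] xi by (smt (verit) mult_nonneg_nonneg)
  then show ?thesis using gamma' by (simp add: Gamma_set_def pos_semidef_iff)
qed

lemma gamma'_le_gamma_plus: "\<gamma>' \<le> gamma_plus q0 q1"
  unfolding gamma_plus_def by (rule cSup_upper[OF gamma'_in_Gamma bdd_above_Gamma])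

text \<open>At 0 the pencil is \<open>a0\<close>, which has a negative direction. Strictness pushes
  the midpoint in \<open>negative_eigenvector\<close> strictly beyond
  \<open>gamma_plus\<close>.\<close>

lemma gamma'_pos: "\<gamma>' > 0"
proof -
  obtain x where x: "ip n x (mv n a0 x) < 0" using negative_direction by blast
  have "\<gamma>' \<noteq> 0"
  proof
    assume "\<gamma>' = 0"
    then have "\<xi> * ip n x x \<le> ip n x (mv n a0 x)" using form_gamma'[of x] by (simp add: form_comb)
    then show False using x xi ip_self_nonneg[of n x] by (smt (verit) mult_nonneg_nonneg)
  qed
  then show ?thesis using gamma' by simp
qed

lemma n_le_nnz': "n \<le> nnz q0 q1"
proof (rule n_le_nnz[where \<gamma> = \<gamma>'])
  show "0 < ip n x (mv n (a \<gamma>') x)" if "ip n x x > 0" for x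
    using form_gamma'[of x] mult_pos_pos[OF xi that] by linarith
qed

text \<open>Otherwise \<gamma> lies between \<gamma>' and another member of
  \<open>Gamma_set\<close>, its form is a convex combination of nonnegative ones, and
  \<open>cheb_bounded\<close> contradicts the certificate.\<close>

lemma certificate_sound:
  assumes g: "\<gamma>' \<le> \<gamma>" "1 \<le> \<gamma>" and cert: "certificate n (a \<gamma>) \<gamma> j v"
  shows "gamma_plus q0 q1 \<le> \<gamma>"
proof (rule ccontr)
  assume "\<not> gamma_plus q0 q1 \<le> \<gamma>"
  then have "\<gamma> < Sup (Gamma_set q0 q1)" by (simp add: gamma_plus_def)
  moreover have "Gamma_set q0 q1 \<noteq> {}" using gamma'_in_Gamma by blast
  ultimately obtain \<gamma>2 where g2: "\<gamma>2 \<in> Gamma_set q0 q1" "\<gamma> < \<gamma>2"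
    using less_cSupD by blast
  define t where "t = (\<gamma> - \<gamma>') / (\<gamma>2 - \<gamma>')"
  have t: "0 \<le> t" "t \<le> 1" using g g2 by (simp_all add: t_def)
  have "t * (\<gamma>2 - \<gamma>') = \<gamma> - \<gamma>'" using g g2 by (simp add: t_def)
  then have "\<gamma> = (1 - t) * \<gamma>' + t * \<gamma>2" by (simp add: algebra_simps)
  note int = form_interpolate[OF this]
  have psd: "0 \<le> ip n x (mv n (a \<gamma>) x)" for x
    unfolding int using t gamma'_in_Gamma g2
    by (intro add_nonneg_nonneg mult_nonneg_nonneg) (auto simp: Gamma_set_def pos_semidef_iff)
  have "sqrt (ip n (cheb n (a \<gamma>) \<gamma> v (2 * j)) (cheb n (a \<gamma>) \<gamma> v (2 * j)))
    \<le> real (2 * j) * sqrt (ip n v v)"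
    by (rule cheb_bounded[OF sym(3) psd form_le]) (use g in auto)
  then have "(sqrt (ip n (cheb n (a \<gamma>) \<gamma> v (2 * j)) (cheb n (a \<gamma>) \<gamma> v (2 *
    j))))\<^sup>2 \<le> (real (2 * j) * sqrt (ip n v v))\<^sup>2"
    by (rule power_mono) (simp add: ip_self_nonneg)
  then show False using cert by (simp add: certificate_def power_mult_distrib ip_self_nonneg)
qed

text \<open>The midpoint of \<gamma>' and \<gamma> exceeds \<open>gamma_plus\<close>, so its form is
  negative somewhere. That form is the mean of those at the two ends, and the one at \<gamma>' is at
  least \<xi> |x|^2, so the smallest eigenvalue at \<gamma> has to compensate.\<close>

lemma negative_eigenvector:
  assumes g: "2 * gamma_plus q0 q1 \<le> \<gamma>"
  shows "\<exists>u l. ip n u u = 1 \<and> (\<forall>i<n. mv n (a \<gamma>) u i = l * u i) \<and> l \<le>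
    - \<xi>"
proof -
  from rayleigh_min[OF n_pos sym(3)[of \<gamma>]] obtain u l where u: "ip n u u = 1" "\<forall>i<n. mv n
    (a \<gamma>) u i = l * u i"
    and l: "\<And>y. l * ip n y y \<le> ip n y (mv n (a \<gamma>) y)" by blast
  have "l \<le> - \<xi>"
  proof (rule ccontr)
    assume "\<not> l \<le> - \<xi>"
    then have pos: "\<xi> + l \<ge> 0" by simp
    define \<gamma>2 where "\<gamma>2 = (1 - 1 / 2) * \<gamma>' + 1 / 2 * \<gamma>"
    have "0 \<le> ip n x (mv n (a \<gamma>2) x)" for x
    proof -
      have "0 \<le> (\<xi> + l) * ip n x x" using pos ip_self_nonneg by simp
      then show ?thesis unfolding form_interpolate[OF \<gamma>2_def]
        using l[of x] form_gamma'[of x] by (simp add: algebra_simps)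
    qed
    moreover have "\<gamma>2 > gamma_plus q0 q1" using gamma'_pos g by (simp add: \<gamma>2_def)
    moreover have "\<gamma>2 \<ge> 0" using gamma'_pos g gamma'_le_gamma_plus by (simp add: \<gamma>2_def)
    ultimately have "\<gamma>2 \<in> Gamma_set q0 q1" by (simp add: Gamma_set_def pos_semidef_iff)
    then have "\<gamma>2 \<le> gamma_plus q0 q1" unfolding gamma_plus_def by (rule cSup_upper[OF _
      bdd_above_Gamma])
    with \<open>\<gamma>2 > _\<close> show False by simp
  qed
  with u show ?thesis by blast
qed

end

section \<open>Correctness and running time\<close>

text \<open>Take logarithms and use ln (1 + x) \<ge> x / (1 + x) \<ge> x / 2.\<close>

lemma iterations_bound:
  assumes x: "0 < x" "x \<le> (1::real)" and R: "(1 + x) ^ j < R"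
  shows "real j \<le> 2 * ln R / x"
proof -
  have "ln (inverse (1 + x)) \<le> inverse (1 + x) - 1" by (rule ln_le_minus_one) (use x in simp)
  then have "1 - inverse (1 + x) \<le> ln (1 + x)" using x by (simp add: ln_inverse)
  moreover have "x / 2 \<le> 1 - inverse (1 + x)"
  proof -
    have "1 - inverse (1 + x) = x / (1 + x)" using x by (simp add: field_simps)
    also have "x / 2 \<le> x / (1 + x)" using x by (intro divide_left_mono) auto
    finally show ?thesis by simp
  qed
  ultimately have "real j * (x / 2) \<le> real j * ln (1 + x)" by (intro mult_left_mono) auto
  also have "\<dots> = ln ((1 + x) ^ j)" using x by (simp add: ln_realpow)
  also have "\<dots> \<le> ln R" using x R by (intro ln_mono) auto
  finally show ?thesis using x by (simp add: field_simps)
qed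

lemma Log_ge_1: "1 \<le> Log x" and Log_nonneg: "0 \<le> Log x" and ln_le_Log: "ln x \<le> Log x"
  by (simp_all add: Log_def)

lemma sum_sqrt_geometric:
  assumes "c \<ge> 0"
  shows "(\<Sum>k\<le>K. sqrt (c * 2 ^ k)) \<le> 4 * sqrt (c * 2 ^ K)"
proof (induction K)
  case (Suc K)
  \<comment> \<open>The induction needs 4 + sqrt 2 \<le> 4 sqrt 2; the limit ratio sqrt 2 / (sqrt 2
    - 1) is about 3.41, and 4 is the next integer.\<close>
  have "4 / 3 \<le> sqrt (2::real)" by (rule real_le_rsqrt) (simp add: power2_eq_square)
  then have "(4 + sqrt 2) * sqrt (c * 2 ^ K) \<le> (4 * sqrt 2) * sqrt (c * 2 ^ K)"
    using assms by (intro mult_right_mono) auto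
  then have "4 * sqrt (c * 2 ^ K) + sqrt 2 * sqrt (c * 2 ^ K) \<le> 4 * (sqrt 2 * sqrt (c * 2 ^ K))"
    by (simp add: algebra_simps)
  moreover have "sqrt 2 * sqrt (c * 2 ^ K) = sqrt (c * 2 ^ Suc K)"
    by (simp add: real_sqrt_mult[symmetric] algebra_simps)
  ultimately show ?case using Suc by simp
qed (use assms in simp)

section \<open>The doubling search on a fixed instance\<close>

locale zeta_instance = feasible_pair +
  fixes es0 es1 :: "(nat \<times> nat) list" and \<zeta>' p :: real
  assumes es: "coordinate_list (qmat q0) es0" "coordinate_list (qmat q1) es1"
    and regular: "regular_pair q0 q1 \<xi> \<zeta>'"
    and p: "0 < p" "p < 1"
begin

abbreviation \<zeta> where "\<zeta> \<equiv> zeta_star q0 q1"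

definition g :: "nat \<Rightarrow> real" where "g k = start_gamma \<gamma>' * 2 ^ k"

text \<open>Matched to the slab half-width e = p / (2 sqrt n) used later: R e = 2 sqrt n, at least
  twice the norm of any start vector in the unit cube.\<close>

definition R :: real where "R = 4 * real n / p"

definition J :: "nat \<Rightarrow> nat" where "J k = (LEAST j. R \<le> (1 + sqrt (\<xi> / g k)) ^ j)"

definition stops :: "(nat \<Rightarrow> real) \<Rightarrow> nat \<Rightarrow> bool" where
  "stops \<omega> k \<longleftrightarrow> certificate n (a (g k)) (g k) (J k) \<omega> \<or> \<zeta>' \<le> g k"

definition K :: "(nat \<Rightarrow> real) \<Rightarrow> nat" where "K \<omega> = (LEAST k. stops \<omega> k)"

lemma zeta: "1 \<le> \<zeta>" "gamma_plus q0 q1 \<le> \<zeta>" "\<zeta> \<le> \<zeta>'"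
  using regular by (auto simp: zeta_star_def regular_pair_def)

lemma xi_le_1: "\<xi> \<le> 1"
  using regular by (auto simp: regular_pair_def xi_star_def)

lemma start_gamma: "1 \<le> start_gamma \<gamma>'" "\<gamma>' \<le> start_gamma \<gamma>'" "start_gamma
  \<gamma>' \<le> \<zeta>"
  using gamma'_le_gamma_plus zeta by (auto simp: start_gamma_def)

lemma mono_g: "k \<le> l \<Longrightarrow> g k \<le> g l"
  using start_gamma by (auto simp: g_def intro!: mult_left_mono power_increasing)

lemma g_ge: "1 \<le> g k" "\<gamma>' \<le> g k"
proof -
  have "start_gamma \<gamma>' \<le> g k" using mono_g[of 0 k] by (simp add: g_def)
  then show "1 \<le> g k" "\<gamma>' \<le> g k" using start_gamma by simp_all
qed

lemma g_unbounded: "\<exists>k. B \<le> g k"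
proof -
  obtain k where "B < 2 ^ k" using real_arch_pow[of 2 B] by auto
  moreover have "2 ^ k \<le> g k" using start_gamma mult_right_mono[of 1 "start_gamma \<gamma>'" "2 ^ k"]
    by (simp add: g_def)
  ultimately show ?thesis by (intro exI[of _ k]) simp
qed

lemma step_size: "0 < sqrt (\<xi> / g k)" "sqrt (\<xi> / g k) \<le> 1"
  using xi xi_le_1 g_ge[of k] by auto

lemma R_gt_1: "1 < R"
proof -
  have "1 \<le> real n" using n_pos by simp
  then show ?thesis using p by (simp add: R_def field_simps)
qed

lemma J_ex: "\<exists>j. R \<le> (1 + sqrt (\<xi> / g k)) ^ j"
  using real_arch_pow[of "1 + sqrt (\<xi> / g k)" R] step_size[of k] by (auto intro: less_imp_le)

lemma R_le_J: "R \<le> (1 + sqrt (\<xi> / g k)) ^ J k"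
  unfolding J_def by (rule LeastI_ex[OF J_ex])

lemma less_J: "j < J k \<Longrightarrow> (1 + sqrt (\<xi> / g k)) ^ j < R"
  using not_less_Least[of j "\<lambda>j. R \<le> (1 + sqrt (\<xi> / g k)) ^ j"] by (auto simp: J_def)

lemma J_pos: "0 < J k"
  using R_le_J[of k] R_gt_1 by (cases "J k") auto

lemma J_le: "real (J k) \<le> 9 * Log (real n / p) / sqrt \<xi> * sqrt (g k)"
proof -
  define x where "x = sqrt (\<xi> / g k)"
  define L where "L = Log (real n / p)"
  have x: "0 < x" "x \<le> 1" using step_size by (simp_all add: x_def)
  have L: "1 \<le> L" "ln (real n / p) \<le> L" by (simp_all add: L_def Log_ge_1 ln_le_Log)
  have R: "R = 4 * (real n / p)" by (simp add: R_def)
  have "ln R = ln 4 + ln (real n / p)" unfolding R by (rule ln_mult_pos) (use n_pos p in auto)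
  then have lnR: "ln R \<le> 4 * L" using L ln_le_minus_one[of 4] by simp
  \<comment> \<open>\<open>J k\<close> is minimal, so its predecessor is still below the threshold
    and costs at most 8 L / x; the last round is covered by one more L / x.\<close>
  have "(1 + x) ^ (J k - 1) < R" unfolding x_def by (rule less_J) (use J_pos in simp)
  from iterations_bound[OF x this] have "real (J k - 1) \<le> 2 * ln R / x" .
  also have "\<dots> \<le> 8 * L / x" using lnR x by (intro divide_right_mono) auto
  finally have "real (J k) \<le> 1 + 8 * L / x" using J_pos[of k] by linarith
  also have "1 \<le> L / x" using L x by (simp add: field_simps)
  finally have "real (J k) \<le> 9 * L / x" by (simp add: add_divide_distrib[symmetric])
  also have "9 * L / x = 9 * L / sqrt \<xi> * sqrt (g k)" by (simp add: x_def real_sqrt_divide)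
  finally show ?thesis by (simp add: L_def)
qed

lemma stops_K: "stops \<omega> (K \<omega>)"
proof -
  have "\<exists>k. stops \<omega> k" using g_unbounded[of \<zeta>'] by (auto simp: stops_def)
  then show ?thesis unfolding K_def by (rule LeastI_ex)
qed

lemma K_le: "stops \<omega> k \<Longrightarrow> K \<omega> \<le> k"
  unfolding K_def by (rule Least_le)

text \<open>Both reasons to stop give the lower bound: a certificate by soundness, reaching \<zeta>'
  by regularity. It therefore holds on every tape, and only the upper bound is a matter of
  chance.\<close>

lemma stops_ge: "stops \<omega> k \<Longrightarrow> \<zeta> \<le> g k"
  using certificate_sound[of "g k" "J k" \<omega>] g_ge[of k] zeta by (auto simp: stops_def zeta_star_def)

abbreviation input :: "(nat \<Rightarrow> real) \<Rightarrow> ram" where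
  "input \<equiv> zeta_input n q0 q1 es0 es1 \<xi> \<zeta>' \<gamma>' p"

lemma length_es: "length es0 + length es1 = nnz q0 q1"
  using es by (simp add: coordinate_list_def nnz_def flip: distinct_card)

lemma halts_input:
  "halts approx_zeta (input \<omega>) (27 * n + (\<Sum>k\<le>K \<omega>. 66 * J k * (n + nnz q0 q1)))
    (\<lambda>s. result s = g (K \<omega>))"
proof -
  have "halts approx_zeta (input \<omega>) (27 * n + (\<Sum>k\<le>K \<omega>. 66 * J k * (n + length es0
    + length es1)))
    (\<lambda>s. result s = g (K \<omega>))"
  proof (rule halts_approx_zeta[OF n_pos])
    show "coo (length es0) (warr (input \<omega>) 0) (warr (input \<omega>) 1) (rarr (input \<omega>) 0) n a0"
      "coo (length es1) (warr (input \<omega>) 2) (warr (input \<omega>) 3) (rarr (input \<omega>) 1) n a1"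
      using coo_coordinate_list[OF carrier(1) es(1)] coo_coordinate_list[OF carrier(2) es(2)]
      by (simp_all add: zeta_input_def)
    show "\<not> (certificate n (a (g k)) (g k) (J k) (rtape (input \<omega>)) \<or> \<zeta>' \<le> g k)"
      if "k < K \<omega>" for k
      using not_less_Least[of k "stops \<omega>"] that by (simp add: K_def stops_def zeta_input_def)
    show "certificate n (a (g (K \<omega>))) (g (K \<omega>)) (J (K \<omega>)) (rtape (input \<omega>))
      \<or> \<zeta>' \<le> g (K \<omega>)"
      using stops_K[of \<omega>] by (simp add: stops_def zeta_input_def)
  qed (use less_J R_le_J in \<open>auto simp: zeta_input_def cells_def g_def J_pos simp flip: R_def\<close>)
  then show ?thesis by (simp add: length_es add.assoc)
qed

lemma time_bound:
  assumes m: "g m \<le> 4 * \<zeta>"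
  shows "real (27 * n + (\<Sum>k\<le>m. 66 * J k * (n + nnz q0 q1)))
    \<le> 9600 * (real (nnz q0 q1) * sqrt \<zeta> / sqrt \<xi> * Log (real n / p))"
proof -
  let ?N = "real (nnz q0 q1)"
  let ?L = "Log (real n / p)"
  let ?B = "?N * sqrt \<zeta> / sqrt \<xi> * ?L"
  have nN: "real n \<le> ?N" using n_le_nnz' by simp
  have c: "0 \<le> 9 * ?L / sqrt \<xi>" using Log_ge_1[of "real n / p"] xi by simp
  have "(\<Sum>k\<le>m. real (J k)) \<le> (\<Sum>k\<le>m. 9 * ?L / sqrt \<xi> * sqrt (g k))"
    by (rule sum_mono) (rule J_le)
  also have "\<dots> = 9 * ?L / sqrt \<xi> * (\<Sum>k\<le>m. sqrt (start_gamma \<gamma>' * 2 ^ k))"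
    by (simp add: sum_distrib_left g_def)
  also have "\<dots> \<le> 9 * ?L / sqrt \<xi> * (4 * sqrt (g m))"
    unfolding g_def using start_gamma by (intro mult_left_mono[OF sum_sqrt_geometric c]) simp
  also have "sqrt (g m) \<le> sqrt (4 * \<zeta>)" using m by simp
  then have "9 * ?L / sqrt \<xi> * (4 * sqrt (g m)) \<le> 9 * ?L / sqrt \<xi> * (4 * (2 * sqrt \<zeta>))"
    by (intro mult_left_mono[OF _ c]) (simp add: real_sqrt_mult)
  finally have sumJ: "(\<Sum>k\<le>m. real (J k)) \<le> 72 * (?L / sqrt \<xi> * sqrt \<zeta>)" by (simp
    add: algebra_simps)
  have "(\<Sum>k\<le>m. real (J k)) * (real n + ?N) \<le> 72 * (?L / sqrt \<xi> * sqrt \<zeta>) * (?N + ?N)"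
    using sumJ nN xi zeta by (intro mult_mono) (auto simp: sum_nonneg Log_nonneg)
  also have "\<dots> = 144 * ?B" by (simp add: algebra_simps)
  finally have main: "(\<Sum>k\<le>m. real (J k)) * (real n + ?N) \<le> 144 * ?B" .
  have "1 \<le> sqrt \<zeta> / sqrt \<xi>"
  proof -
    have "sqrt \<xi> \<le> sqrt \<zeta>" using xi_le_1 zeta by simp
    then show ?thesis using xi by simp
  qed
  then have "1 * 1 \<le> sqrt \<zeta> / sqrt \<xi> * ?L" using Log_ge_1 by (intro mult_mono) auto
  then have "?N * 1 \<le> ?N * (sqrt \<zeta> / sqrt \<xi> * ?L)" by (intro mult_left_mono) auto
  then have nB: "real n \<le> ?B" using nN by simp
  \<comment> \<open>Here 144 = 9 * 4 * 2 * 2 combines \<open>J_le\<close>, the geometric sum, the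
    root of 4 \<zeta> and n + N \<le> 2 N; then 66 * 144 + 27 = 9531.\<close>
  have "27 * x + 66 * y \<le> 9600 * b" if "x \<le> b" "y \<le> 144 * b" "0 \<le> x" for x y b :: real
    using that by linarith
  from this[OF nB main] have "27 * real n + 66 * ((\<Sum>k\<le>m. real (J k)) * (real n + ?N)) \<le> 9600 * ?B"
    by simp
  moreover have "real (27 * n + (\<Sum>k\<le>m. 66 * J k * (n + nnz q0 q1)))
    = 27 * real n + 66 * ((\<Sum>k\<le>m. real (J k)) * (real n + ?N))"
    by (simp add: sum_distrib_left sum_distrib_right mult.assoc)
  ultimately show ?thesis by (simp only:)
qed

text \<open>Replaces the quantifier over runs by a countable union of explicit conditions on the
  tape, which is measurable. An early stop bounds output and time at once; the converse is
  determinism.\<close>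

lemma success_event:
  fixes B :: real
  assumes B: "\<And>k. g k \<le> 4 * \<zeta> \<Longrightarrow> real (27 * n + (\<Sum>i\<le>k. 66 * J i *
    (n + nnz q0 q1))) \<le> B"
  shows "(\<exists>t s. runs approx_zeta (input \<omega>) t s \<and> \<zeta> \<le> result s \<and> result
    s \<le> 4 * \<zeta> \<and> real t \<le> B)
    \<longleftrightarrow> (\<exists>k. g k \<le> 4 * \<zeta> \<and> stops \<omega> k)" (is "?L
      \<longleftrightarrow> ?R")
proof -
  from halts_input[of \<omega>] obtain t s where run: "runs approx_zeta (input \<omega>) t s"
    and t: "t \<le> 27 * n + (\<Sum>k\<le>K \<omega>. 66 * J k * (n + nnz q0 q1))" and s: "result s = g
      (K \<omega>)"
    by (auto simp: halts_def)
  show ?thesis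
  proof
    assume ?L
    then have "g (K \<omega>) \<le> 4 * \<zeta>" using runs_deterministic[OF run] s by auto
    then show ?R using stops_K by blast
  next
    assume ?R
    then obtain k where k: "g k \<le> 4 * \<zeta>" "stops \<omega> k" by blast
    have "g (K \<omega>) \<le> 4 * \<zeta>" using mono_g[OF K_le[OF k(2)]] k(1) by simp
    moreover have "real t \<le> B" using t B[OF calculation] by linarith
    ultimately show ?L using run s stops_ge[OF stops_K[of \<omega>]] by (intro exI[of _ t] exI[of _ s]) simp
  qed
qed

lemma success_probability:
  "1 - p \<le> measure tape_measure {\<omega> \<in> space tape_measure. \<exists>k. g k \<le> 4 * \<zeta>
    \<and> stops \<omega> k}"
    (is "_ \<le> measure _ ?G")
proof -
  interpret T: prob_space tape_measure by (rule prob_space_tape)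
  \<comment> \<open>\<open>m\<close> does not depend on the tape, so its eigenvector is fixed before
    the randomness is drawn. Unless \<open>m\<close> is 0, minimality puts the preceding value below
    twice \<open>gamma_plus\<close>, whence the factor 4.\<close>
  define m where "m = (LEAST k. 2 * gamma_plus q0 q1 \<le> g k)"
  have m: "2 * gamma_plus q0 q1 \<le> g m"
    unfolding m_def using g_unbounded by (rule LeastI_ex)
  have g_m: "g m \<le> 4 * \<zeta>"
  proof (cases m)
    case 0
    then show ?thesis using start_gamma zeta by (simp add: g_def)
  next
    case (Suc k)
    then have "g k < 2 * gamma_plus q0 q1"
      using not_less_Least[of k "\<lambda>k. 2 * gamma_plus q0 q1 \<le> g k"] by (simp add: m_def)
    then show ?thesis using Suc zeta by (simp add: g_def)
  qed
  obtain u l where u: "ip n u u = 1" "\<And>i. i < n \<Longrightarrow> mv n (a (g m)) u i = l * u i" "l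
    \<le> - \<xi>"
    using negative_eigenvector[OF m] by blast
  \<comment> \<open>Chosen so that \<open>prob_slab\<close> gives failure probability exactly
    \<open>p\<close>.\<close>
  define e where "e = p / (2 * sqrt (real n))"
  have e: "e \<ge> 0" "2 * e * sqrt (real n) = p"
    using p n_pos by (simp_all add: e_def)
  have "R * e = 2 * (real n / sqrt (real n))" using p by (simp add: e_def R_def)
  then have Re: "R * e = 2 * sqrt (real n)" by (simp add: real_div_sqrt)
  let ?B = "{\<omega> \<in> space tape_measure. \<bar>ip n u \<omega>\<bar> \<le> e}"
  have B: "?B \<in> sets tape_measure" unfolding ip_def by measurable
  have G: "?G \<in> sets tape_measure" unfolding stops_def certificate_def ip_def by measurable
  have stops: "stops \<omega> m" if \<omega>: "\<forall>i<n. 0 \<le> \<omega> i \<and> \<omega> i \<le>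
    1" and big: "e < \<bar>ip n u \<omega>\<bar>" for \<omega>
  proof -
    have "ip n \<omega> \<omega> \<le> (\<Sum>i<n. 1)"
      unfolding ip_def using \<omega> by (intro sum_mono) (auto intro: mult_le_one)
    then have "2 * sqrt (ip n \<omega> \<omega>) \<le> R * e" by (simp add: Re)
    also have "\<dots> < R * \<bar>ip n u \<omega>\<bar>" using big R_gt_1 by (intro mult_strict_left_mono) auto
    finally have "certificate n (a (g m)) (g m) (J m) \<omega>"
      unfolding certificate_def using xi g_ge[of m] J_pos
      by (intro cheb_detects[OF sym(3) u(2,1,3) _ _ _ R_le_J]) auto
    then show ?thesis by (simp add: stops_def)
  qed
  have "1 - p \<le> 1 - measure tape_measure ?B" using prob_slab[OF u(1) e(1)] e(2) by simp
  also have "\<dots> = measure tape_measure (space tape_measure - ?B)" by (rule T.prob_compl[OF B, symmetric])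
  \<comment> \<open>Tape cells lie in [0, 1] only almost surely, so the events are included up to a
    null set.\<close>
  also have "\<dots> \<le> measure tape_measure ?G"
    using AE_tape_bounded[of n]
    by (intro T.finite_measure_mono_AE[OF _ G], eventually_elim) (use stops g_m in \<open>auto simp:
      not_le\<close>)
  finally show ?thesis .
qed

end

theorem theorem9:
  shows "\<exists>ApproxZeta :: prog. \<exists>C > 0. \<exists>m :: nat.
    \<forall>n q0 q1 es0 es1 \<xi> \<zeta>' \<gamma>' p.
      assumption_A n q0 q1 \<and>
      coordinate_list (qmat q0) es0 \<and> coordinate_list (qmat q1) es1 \<and>
      regular_pair q0 q1 \<xi> \<zeta>' \<and>
      \<gamma>' \<ge> 0 \<and> lambda_min (pencil q0 q1 \<gamma>') \<ge> \<xi> \<and>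
      p > 0 \<longrightarrow>
      measure tape_measure {\<omega> \<in> space tape_measure.
        \<exists>t s. runs ApproxZeta (zeta_input n q0 q1 es0 es1 \<xi> \<zeta>' \<gamma>' p \<omega>) t
          s \<and>
          zeta_star q0 q1 \<le> result s \<and> result s \<le> 4 * zeta_star q0 q1 \<and>
          real t \<le> C *
            (real (nnz q0 q1) * sqrt (zeta_star q0 q1) / sqrt \<xi> *
              Log (real n / p) * Log (1 / \<xi>) * (Log (\<zeta>' / zeta_star q0 q1))\<^sup>2) *
            (LogLog (real n) * LogLog (1 / p) * LogLog (1 / \<xi>) * LogLog \<zeta>') ^ m}
        \<ge> 1 - p"
proof (rule exI[of _ approx_zeta], rule exI[of _ 9600], intro conjI exI[of _ 0] allI impI)
  fix n q0 q1 es0 es1 \<xi> \<zeta>' \<gamma>' and p :: real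
  assume H: "assumption_A n q0 q1 \<and>
      coordinate_list (qmat q0) es0 \<and> coordinate_list (qmat q1) es1 \<and>
      regular_pair q0 q1 \<xi> \<zeta>' \<and>
      \<gamma>' \<ge> 0 \<and> lambda_min (pencil q0 q1 \<gamma>') \<ge> \<xi> \<and> p > 0"
  \<comment> \<open>The constant is that of \<open>time_bound\<close>, which contains no iterated
    logarithms; hence the exponent 0.\<close>
  let ?B = "9600 * (real (nnz q0 q1) * sqrt (zeta_star q0 q1) / sqrt \<xi> *
              Log (real n / p) * Log (1 / \<xi>) * (Log (\<zeta>' / zeta_star q0 q1))\<^sup>2) *
            (LogLog (real n) * LogLog (1 / p) * LogLog (1 / \<xi>) * LogLog \<zeta>') ^ 0"
  let ?G = "{\<omega> \<in> space tape_measure.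
        \<exists>t s. runs approx_zeta (zeta_input n q0 q1 es0 es1 \<xi> \<zeta>' \<gamma>' p \<omega>) t
          s \<and>
          zeta_star q0 q1 \<le> result s \<and> result s \<le> 4 * zeta_star q0 q1 \<and> real t \<le> ?B}"
  show "measure tape_measure ?G \<ge> 1 - p"
  proof (cases "p < 1")
    case False
    then show ?thesis using measure_nonneg[of tape_measure ?G] by linarith
  next
    case True
    interpret zeta_instance n q0 q1 \<xi> \<gamma>' es0 es1 \<zeta>' p
      using H True by unfold_locales (auto simp: regular_pair_def)
    let ?b = "real (nnz q0 q1) * sqrt (zeta_star q0 q1) / sqrt \<xi> * Log (real n / p)"
    have "0 \<le> ?b" using Log_ge_1[of "real n / p"] xi zeta by simp
    \<comment> \<open>\<open>Log\<close> is at least 1, so multiplying by the remaining factors only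
      weakens \<open>time_bound\<close>.\<close>
    moreover have "1 * 1 \<le> Log (1 / \<xi>) * (Log (\<zeta>' / zeta_star q0 q1))\<^sup>2"
      using Log_ge_1 by (intro mult_mono one_le_power) (auto simp: Log_nonneg)
    ultimately have "?b * 1 \<le> ?b * (Log (1 / \<xi>) * (Log (\<zeta>' / zeta_star q0 q1))\<^sup>2)"
      by (intro mult_left_mono) auto
    then have "9600 * ?b \<le> ?B" by (simp add: mult.assoc)
    then have "real (27 * n + (\<Sum>i\<le>k. 66 * J i * (n + nnz q0 q1))) \<le> ?B" if "g k \<le> 4 *
      zeta_star q0 q1" for k
      using time_bound[OF that] by linarith
    from success_event[OF this] success_probability show ?thesis by simp
  qed
qed simp

end
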